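(* Fix $k\ge 2$. In the space of smooth skew product maps $F:\mathbb{T}^2\to\mathbb{T}^2$, $F(y,x)=(g(y),f_y(x))$, endowed with the $C^k$ topology, there is a nonempty open set $\mathcal{U}$ of maps $F$ for which $g$ is an expanding circle map and each $f_y$ is a circle diffeomorphism, such that every $F\in\mathcal{U}$ has the following properties: \begin{enumerate} \item $F$ is topologically mixing on $\mathbb{T}^2$; \item there is a subset $\Lambda\subset\mathbb{T}^2$ of full Lebesgue measure such that for any $(y,x_1),(y,x_2)\in\Lambda$ (two points with the same first coordinate), $$\lim_{n\to\infty}|F^n(y,x_1)-F^n(y,x_2)|=0.$$ \end{enumerate}
   Context: $\mathbb{T}=\mathbb{R}/\mathbb{Z}$, $\mathbb{T}^2=(\mathbb{R}/\mathbb{Z})^2$, and $|p-q|$ denotes the distance between points $p,q\in\mathbb{T}^2$. A smooth skew product map (forced circle diffeomorphism) on $\mathbb{T}^2$ is a smooth map $F(y,x)=(g(y),f_y(x))$, where $g:\mathbb{T}\to\mathbb{T}$ is a smooth endomorphism and each $f_y:\mathbb{T}\to\mathbb{T}$ is a diffeomorphism depending smoothly on $y$. The space of such maps is a subset of the space of smooth endomorphisms of $\mathbb{T}^2$, with the induced $C^k$ topology. A smooth endomorphism $g$ of the circle is expanding if $|g'|>1$ everywhere. $F$ is topologically mixing if for each pair of nonempty open sets $U,V\subset\mathbb{T}^2$, $F^n(U)$ intersects $V$ for all large enough positive integers $n$. *)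

theory Defs
  imports "HOL-Analysis.Analysis"
begin

quotient_type circle = real / "\<lambda>x y :: real. x - y \<in> \<int>"
  morphisms rep_circle to_circle
proof (rule equivpI)
  show "reflp (\<lambda>x y :: real. x - y \<in> \<int>)"
    by (simp add: reflp_def)
  show "symp (\<lambda>x y :: real. x - y \<in> \<int>)"
    unfolding symp_def by (metis Ints_minus minus_diff_eq)
  show "transp (\<lambda>x y :: real. x - y \<in> \<int>)"
    unfolding transp_def by (metis Ints_add diff_add_cancel add_diff_eq)
qed

lemma to_circle_eq_iff: "to_circle x = to_circle y \<longleftrightarrow> x - y \<in> \<int>"
  by (simp add: circle.abs_eq_iff)

lemma round_diff_cong:
  fixes s t :: real
  assumes "s - t \<in> \<int>"
  shows "\<bar>s - of_int (round s)\<bar> = \<bar>t - of_int (round t)\<bar>"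
proof -
  have le: "\<bar>u - of_int (round u)\<bar> \<le> \<bar>v - of_int (round v)\<bar>"
    if "u - v \<in> \<int>" for u v :: real
  proof -
    from that obtain n where n: "u - v = of_int n"
      by (auto elim: Ints_cases)
    have "\<bar>u - of_int (round u)\<bar> \<le> \<bar>u - of_int (round v + n)\<bar>"
      by (rule round_diff_minimal)
    also have "u - of_int (round v + n) = v - of_int (round v)"
      using n by simp
    finally show ?thesis .
  qed
  have "t - s \<in> \<int>"
    using assms by (metis Ints_minus minus_diff_eq)
  then show ?thesis
    using le[OF assms] le[of t s] by simp
qed

instantiation circle :: metric_space
begin

text \<open>The distance of two classes is the distance of \<open>x - y\<close> to the nearest integer.\<close>

lift_definition dist_circle :: "circle \<Rightarrow> circle \<Rightarrow> real"
  is "\<lambda>x y. \<bar>(x - y) - of_int (round (x - y))\<bar>"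
proof -
  fix x x' y y' :: real
  assume "x - x' \<in> \<int>" "y - y' \<in> \<int>"
  then have "(x - x') - (y - y') \<in> \<int>"
    by (rule Ints_diff)
  then have "(x - y) - (x' - y') \<in> \<int>"
    by (simp add: algebra_simps)
  then show "\<bar>(x - y) - of_int (round (x - y))\<bar> = \<bar>(x' - y') - of_int (round (x' - y'))\<bar>"
    by (rule round_diff_cong)
qed

definition uniformity_circle :: "(circle \<times> circle) filter"
  where "uniformity_circle = (INF e\<in>{0 <..}. principal {(x, y). dist x y < e})"

definition open_circle :: "circle set \<Rightarrow> bool"
  where "open_circle U \<longleftrightarrow> (\<forall>x\<in>U. eventually (\<lambda>(x', y). x' = x \<longrightarrow> y \<in> U) uniformity)"

instance
proof
  show "uniformity = (INF e\<in>{0 <..}. principal {(x, y :: circle). dist x y < e})"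
    by (rule uniformity_circle_def)
  show "open U \<longleftrightarrow> (\<forall>x\<in>U. \<forall>\<^sub>F (x', y) in uniformity. x' = x \<longrightarrow> y \<in> U)"
    for U :: "circle set"
    by (rule open_circle_def)
  show "dist x y = 0 \<longleftrightarrow> x = y" for x y :: circle
  proof (transfer)
    fix x y :: real
    show "\<bar>x - y - of_int (round (x - y))\<bar> = 0 \<longleftrightarrow> x - y \<in> \<int>"
      by (auto elim!: Ints_cases) (metis Ints_of_int)
  qed
  show "dist x y \<le> dist x z + dist y z" for x y z :: circle
  proof (transfer)
    fix x y z :: real
    let ?m = "round (x - z)" and ?n = "round (y - z)"
    have "\<bar>x - y - of_int (round (x - y))\<bar> \<le> \<bar>x - y - of_int (?m - ?n)\<bar>"
      by (rule round_diff_minimal)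
    also have "\<dots> = \<bar>(x - z - of_int ?m) - (y - z - of_int ?n)\<bar>"
      by simp
    also have "\<dots> \<le> \<bar>x - z - of_int ?m\<bar> + \<bar>y - z - of_int ?n\<bar>"
      by (rule abs_triangle_ineq4)
    finally show "\<bar>x - y - of_int (round (x - y))\<bar>
        \<le> \<bar>x - z - of_int ?m\<bar> + \<bar>y - z - of_int ?n\<bar>" .
  qed
qed

end

lemma dist_to_circle:
  "dist (to_circle x) (to_circle y) = \<bar>(x - y) - of_int (round (x - y))\<bar>"
  by (rule dist_circle.abs_eq)

lemma dist_to_circle_le: "dist (to_circle x) (to_circle y) \<le> dist x y"
  using round_diff_minimal[of "x - y" 0] by (simp add: dist_to_circle dist_real_def)

lemma continuous_on_to_circle: "continuous_on S to_circle"
  unfolding continuous_on_iff using dist_to_circle_le le_less_trans by blast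

text \<open>The metric topology is the quotient topology of \<open>\<real>/\<int>\<close>.\<close>

lemma open_circle_iff: "open U \<longleftrightarrow> open (to_circle -` U)"
proof
  assume "open U"
  then show "open (to_circle -` U)"
    using continuous_on_to_circle by (rule open_vimage)
next
  assume op: "open (to_circle -` U)"
  show "open U"
    unfolding open_dist
  proof
    fix p assume "p \<in> U"
    obtain x where p: "p = to_circle x"
      by (metis Quotient_circle Quotient_abs_rep)
    with op \<open>p \<in> U\<close> obtain e where e: "e > 0" "\<And>y. dist y x < e \<Longrightarrow> to_circle y \<in> U"
      unfolding open_dist by auto
    have "q \<in> U" if "dist q p < e" for q
    proof -
      obtain y where q: "q = to_circle y"
        by (metis Quotient_circle Quotient_abs_rep)
      let ?y = "y - of_int (round (y - x))"
      have "dist ?y x < e"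
        using that by (simp add: p q dist_to_circle dist_real_def algebra_simps)
      moreover have "to_circle ?y = q"
        by (simp add: q to_circle_eq_iff)
      ultimately show ?thesis
        using e(2) by metis
    qed
    then show "\<exists>e>0. \<forall>q. dist q p < e \<longrightarrow> q \<in> U"
      using e(1) by blast
  qed
qed

type_synonym torus = "circle \<times> circle"

definition to_torus :: "real \<times> real \<Rightarrow> torus"
  where "to_torus = map_prod to_circle to_circle"

lemma continuous_on_to_torus: "continuous_on S to_torus"
  unfolding to_torus_def map_prod_def case_prod_beta
  by (intro continuous_on_Pair continuous_on_compose2[OF continuous_on_to_circle[of UNIV]]
      continuous_on_fst continuous_on_snd continuous_on_id) auto

definition torus_lebesgue :: "torus measure"
  where "torus_lebesgue =
    completion (distr (restrict_space lborel ({0..<1} \<times> {0..<1})) borel to_torus)"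

lemma measurable_to_torus:
  "to_torus \<in> borel_measurable (restrict_space lborel ({0..<1} \<times> {0..<1}))"
  by (rule measurable_restrict_space1)
    (simp add: borel_measurable_continuous_onI continuous_on_to_torus)

text \<open>\<open>iter_deriv [v\<^sub>1, \<dots>, v\<^sub>m] A\<close> is the iterated directional derivative
  \<open>\<partial>\<^sub>v\<^sub>1 \<dots> \<partial>\<^sub>v\<^sub>m A\<close>.\<close>

fun iter_deriv ::
  "'a::real_normed_vector list \<Rightarrow> ('a \<Rightarrow> 'b::real_normed_vector) \<Rightarrow> 'a \<Rightarrow> 'b"
  where
    "iter_deriv [] A = A"
  | "iter_deriv (v # vs) A = (\<lambda>z. frechet_derivative (iter_deriv vs A) (at z) v)"

text \<open>\<open>C\<^sup>\<infinity>\<close>: every iterated partial derivative exists and is differentiable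
  (hence continuous) everywhere.\<close>

definition smooth :: "('a::euclidean_space \<Rightarrow> 'b::real_normed_vector) \<Rightarrow> bool"
  where "smooth A \<longleftrightarrow> (\<forall>vs. set vs \<subseteq> Basis \<longrightarrow> (\<forall>z. iter_deriv vs A differentiable at z))"

text \<open>Smooth maps of the circle and of the torus are described by their smooth lifts to the
  universal covers; a lift is unique up to an integer translation, so its derivatives of
  positive order depend only on the map.\<close>

definition circle_lift :: "(real \<Rightarrow> real) \<Rightarrow> (circle \<Rightarrow> circle) \<Rightarrow> bool"
  where "circle_lift A f \<longleftrightarrow> smooth A \<and> (\<forall>t. to_circle (A t) = f (to_circle t))"

definition torus_lift :: "(real \<times> real \<Rightarrow> real \<times> real) \<Rightarrow> (torus \<Rightarrow> torus) \<Rightarrow> bool"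
  where "torus_lift A F \<longleftrightarrow> smooth A \<and> (\<forall>z. to_torus (A z) = F (to_torus z))"

definition smooth_circle_map :: "(circle \<Rightarrow> circle) \<Rightarrow> bool"
  where "smooth_circle_map f \<longleftrightarrow> (\<exists>A. circle_lift A f)"

definition smooth_torus_map :: "(torus \<Rightarrow> torus) \<Rightarrow> bool"
  where "smooth_torus_map F \<longleftrightarrow> (\<exists>A. torus_lift A F)"

definition circle_diffeo :: "(circle \<Rightarrow> circle) \<Rightarrow> bool"
  where "circle_diffeo f \<longleftrightarrow> bij f \<and> smooth_circle_map f \<and> smooth_circle_map (inv f)"

definition expanding :: "(circle \<Rightarrow> circle) \<Rightarrow> bool"
  where "expanding g \<longleftrightarrow> (\<exists>A. circle_lift A g \<and> (\<forall>t. \<bar>deriv A t\<bar> > 1))"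

definition skew_product :: "(circle \<Rightarrow> circle) \<Rightarrow> (circle \<Rightarrow> circle \<Rightarrow> circle) \<Rightarrow> torus \<Rightarrow> torus"
  where "skew_product g f = (\<lambda>(y, x). (g y, f y x))"

text \<open>Smooth dependence of \<open>f y\<close> on \<open>y\<close> is the joint smoothness of the map on the torus.\<close>

definition smooth_skew_products :: "(torus \<Rightarrow> torus) set"
  where "smooth_skew_products =
    {skew_product g f | g f. smooth_torus_map (skew_product g f) \<and>
       smooth_circle_map g \<and> (\<forall>y. circle_diffeo (f y))}"

text \<open>\<open>F\<close> and \<open>G\<close> are \<open>\<epsilon>\<close>-close in \<open>C\<^sup>k\<close> if suitable lifts of them, together with
  all partial derivatives of order at most \<open>k\<close>, are uniformly \<open>\<epsilon>\<close>-close.\<close>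

definition Ck_close :: "nat \<Rightarrow> real \<Rightarrow> (torus \<Rightarrow> torus) \<Rightarrow> (torus \<Rightarrow> torus) \<Rightarrow> bool"
  where "Ck_close k \<epsilon> F G \<longleftrightarrow>
    (\<exists>A B. torus_lift A F \<and> torus_lift B G \<and>
      (\<forall>vs z. set vs \<subseteq> Basis \<and> length vs \<le> k \<longrightarrow>
         dist (iter_deriv vs A z) (iter_deriv vs B z) < \<epsilon>))"

definition Ck_topology :: "nat \<Rightarrow> (torus \<Rightarrow> torus) topology"
  where "Ck_topology k = topology (\<lambda>\<U>. \<U> \<subseteq> Collect smooth_torus_map \<and>
    (\<forall>F\<in>\<U>. \<exists>\<epsilon>>0. \<forall>G. Ck_close k \<epsilon> F G \<longrightarrow> G \<in> \<U>))"

lemma Ck_close_mono: "Ck_close k \<delta> F G \<Longrightarrow> \<delta> \<le> \<epsilon> \<Longrightarrow> Ck_close k \<epsilon> F G"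
  unfolding Ck_close_def by (meson less_le_trans)

lemma openin_Ck_topology:
  "openin (Ck_topology k) \<U> \<longleftrightarrow> \<U> \<subseteq> Collect smooth_torus_map \<and>
    (\<forall>F\<in>\<U>. \<exists>\<epsilon>>0. \<forall>G. Ck_close k \<epsilon> F G \<longrightarrow> G \<in> \<U>)"
proof -
  let ?P = "\<lambda>\<U>. \<U> \<subseteq> Collect smooth_torus_map \<and>
    (\<forall>F\<in>\<U>. \<exists>\<epsilon>>0. \<forall>G. Ck_close k \<epsilon> F G \<longrightarrow> G \<in> \<U>)"
  have "istopology ?P"
    unfolding istopology_def
  proof (intro conjI allI impI)
    fix S T assume S: "?P S" and T: "?P T"
    then show "S \<inter> T \<subseteq> Collect smooth_torus_map"
      by blast
    show "\<forall>F\<in>S \<inter> T. \<exists>\<epsilon>>0. \<forall>G. Ck_close k \<epsilon> F G \<longrightarrow> G \<in> S \<inter> T"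
    proof
      fix F assume "F \<in> S \<inter> T"
      with S T obtain a b where
        "a > 0" "\<forall>G. Ck_close k a F G \<longrightarrow> G \<in> S"
        "b > 0" "\<forall>G. Ck_close k b F G \<longrightarrow> G \<in> T"
        by (metis IntD1 IntD2)
      then show "\<exists>\<epsilon>>0. \<forall>G. Ck_close k \<epsilon> F G \<longrightarrow> G \<in> S \<inter> T"
        by (intro exI[of _ "min a b"])
          (auto dest: Ck_close_mono[where \<epsilon> = a] Ck_close_mono[where \<epsilon> = b])
    qed
  next
    fix \<K> assume "\<forall>K\<in>\<K>. ?P K"
    then show "\<Union>\<K> \<subseteq> Collect smooth_torus_map"
      by blast
    show "\<forall>F\<in>\<Union>\<K>. \<exists>\<epsilon>>0. \<forall>G. Ck_close k \<epsilon> F G \<longrightarrow> G \<in> \<Union>\<K>"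
      using \<open>\<forall>K\<in>\<K>. ?P K\<close> by (meson UnionE UnionI)
  qed
  then show ?thesis
    unfolding Ck_topology_def by (simp add: topology_inverse')
qed

lemma topspace_Ck_topology: "topspace (Ck_topology k) = Collect smooth_torus_map"
proof
  show "topspace (Ck_topology k) \<subseteq> Collect smooth_torus_map"
    using openin_topspace openin_Ck_topology by blast
  have "smooth_torus_map G" if "Ck_close k 1 F G" for F G
    using that unfolding Ck_close_def smooth_torus_map_def by blast
  then have "openin (Ck_topology k) (Collect smooth_torus_map)"
    unfolding openin_Ck_topology using zero_less_one by blast
  then show "Collect smooth_torus_map \<subseteq> topspace (Ck_topology k)"
    by (rule openin_subset)
qed

definition skew_product_topology :: "nat \<Rightarrow> (torus \<Rightarrow> torus) topology"
  where "skew_product_topology k = subtopology (Ck_topology k) smooth_skew_products"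

definition topologically_mixing :: "('a::topological_space \<Rightarrow> 'a) \<Rightarrow> bool"
  where "topologically_mixing F \<longleftrightarrow>
    (\<forall>U V. open U \<and> U \<noteq> {} \<and> open V \<and> V \<noteq> {} \<longrightarrow>
      (\<forall>\<^sub>F n in sequentially. (F ^^ n) ` U \<inter> V \<noteq> {}))"

end

theory Submission
  imports Defs
begin

text \<open>
  The open set consists of the skew products that are \<open>C\<^sup>1\<close>-close to the model
  \<open>F\<^sub>0 (y, x) = (N y, x + sin (2 \<pi> (x + y)) / (4 \<pi>))\<close> with \<open>N = 10\<^sup>6\<close>. Two features of the
  model drive everything. Its base map expands so strongly that the \<open>N\<close> preimages of a base point
  are almost equidistributed while everything else is almost constant on the scale \<open>1/N\<close>. Its fibre
  maps are one non-rigid circle diffeomorphism, placed at all phases as \<open>y\<close> runs through the base.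

  \<^emph>\<open>Synchronization.\<close> The fibre map at \<open>y\<close> multiplies an arc of length at most \<open>1/2\<close> by \<open>1 + V\<close>, where \<open>V\<close> is a
  cosine of the phase, so \<open>V\<close> has average \<open>0\<close> over \<open>N\<close> equidistributed values of \<open>y\<close>. By strict
  concavity of the square root, the average of \<open>\<surd>(1 + V)\<close> is at most some \<open>\<kappa> < 1\<close> that does not
  depend on the arc. An orbit pair that starts over a unit interval of the base stays over two almost
  horizontal curves, since the forced slope is divided by about \<open>N\<close> at each step. Hence the arc
  between the two curves can be regarded as constant during a step, and the average of the square root
  of the distance decays like \<open>\<kappa>\<^sup>n\<close> (lemma \<open>average_contraction\<close>). These averages are summable,
  so for fixed \<open>x\<close>, \<open>x'\<close> the distance tends to \<open>0\<close> over almost every \<open>y\<close>. The set \<open>\<Lambda>\<close> consists of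
  the points that are asymptotic to the point \<open>(y, 0)\<close> of their own fibre: Fubini makes it full, and
  the triangle inequality synchronizes any two of its points over the same \<open>y\<close>.

  \<^emph>\<open>Mixing.\<close> Let \<open>J\<close> be a short vertical segment inside \<open>V\<close>. Among the \<open>N\<close> preimages of \<open>J\<close> there is
  always one whose phase makes the inverse fibre map lengthen it by a definite fraction of
  \<open>min \<ell> (1 - \<ell>)\<close> (lemma \<open>preimage_growth\<close>). Pulling back repeatedly, the lengths increase to \<open>1\<close>: the
  segment fills its fibre up to an arbitrarily small gap. A bounded number of further preimages,
  chosen only by their base coordinate, brings it over the shadow of \<open>U\<close> with a gap smaller than the
  height of \<open>U\<close>. So \<open>F\<^sup>n U\<close> meets \<open>V\<close> for every large \<open>n\<close>.

  All estimates are of first order, so both arguments survive every perturbation that is small in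
  \<open>C\<^sup>1\<close>. Closeness is imposed on derivatives of lifts alone. These do not depend on
  the choice of the lift, which makes openness immediate.
\<close>

section \<open>The displacement of the model fibre maps\<close>

text \<open>Scaling by \<open>1/(4 \<pi>)\<close> gives the displacement a derivative between \<open>-1/2\<close> and \<open>1/2\<close>, so that adding
  it to the identity yields a diffeomorphism with derivative between \<open>1/2\<close> and \<open>3/2\<close>.\<close>

definition wobble :: "real \<Rightarrow> real" where "wobble t = sin (2 * pi * t) / (4 * pi)"

text \<open>The normalized sinc function; the value at \<open>0\<close> is its continuous extension.\<close>

definition sinc_pi :: "real \<Rightarrow> real" where "sinc_pi d = (if d = 0 then 1 else sin (pi * d) / (pi * d))"

text \<open>Relative change of length of the arc \<open>[t, t + d]\<close> under \<open>t \<mapsto> t + wobble t\<close>. As a function of the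
  phase \<open>t\<close> it is a pure cosine, whose sums over equidistributed phases are explicit. At \<open>d = 0\<close> it
  is the derivative of \<open>wobble\<close>.\<close>

definition stretch :: "real \<Rightarrow> real \<Rightarrow> real" where "stretch t d = sinc_pi d * cos (2 * pi * t + pi * d) / 2"

lemma wobble_diff: "wobble (t + d) - wobble t = sin (pi * d) * cos (2 * pi * t + pi * d) / (2 * pi)"
proof -
  have "sin (2*pi*(t+d)) - sin (2*pi*t) = 2 * sin ((2*pi*(t+d) - 2*pi*t)/2) * cos ((2*pi*(t+d) + 2*pi*t)/2)"
    by (rule sin_diff_sin)
  moreover have "(2*pi*(t+d) - 2*pi*t)/2 = pi*d" "(2*pi*(t+d) + 2*pi*t)/2 = 2*pi*t+pi*d"
    by (simp_all add: algebra_simps)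
  ultimately have *: "sin (2*pi*(t+d)) - sin (2*pi*t) = 2 * sin (pi*d) * cos (2*pi*t+pi*d)"
    by simp
  show ?thesis
    unfolding wobble_def diff_divide_distrib[symmetric] * by (simp add: field_simps)
qed

lemma wobble_diff_stretch: "wobble (t + d) - wobble t = d * stretch t d"
  unfolding wobble_diff stretch_def sinc_pi_def by (simp add: field_simps)

lemma wobble_periodic: "wobble (t + 1) = wobble t"
  using wobble_diff[of t 1] by simp

text \<open>Monotonicity of \<open>sin t - t cos t\<close> gives \<open>t cos t \<le> sin t\<close>. At \<open>t = x/2\<close> the doubling formula turns
  this into \<open>x cos\<^sup>2 (x/2) \<le> sin x\<close>, and \<open>cos\<^sup>2 (x/2) \<ge> 1/2\<close> because \<open>cos x \<ge> 0\<close>.\<close>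

lemma half_le_sin: assumes "0 \<le> x" "x \<le> pi/2" shows "x / 2 \<le> sin x"
proof -
  have c: "cos (x/2) > 0" using assms pi_gt3 by (intro cos_gt_zero_pi) auto
  have "x/2 * cos (x/2) \<le> sin (x/2)"
  proof -
    let ?f = "\<lambda>t. sin t - t * cos t"
    have "?f 0 \<le> ?f (x/2)"
    proof (rule DERIV_nonneg_imp_nondecreasing[where f = ?f])
      show "0 \<le> x/2" using assms by simp
    next
      fix t assume t: "0 \<le> t" "t \<le> x/2"
      have "(?f has_real_derivative t * sin t) (at t)"
        by (auto intro!: derivative_eq_intros)
      moreover have "0 \<le> t * sin t" using t assms pi_gt3 by (intro mult_nonneg_nonneg sin_ge_zero) auto
      ultimately show "\<exists>y. (?f has_real_derivative y) (at t) \<and> 0 \<le> y" by blast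
    qed
    then show ?thesis by simp
  qed
  then have "x/2 * cos (x/2) * (2 * cos (x/2)) \<le> sin (x/2) * (2 * cos (x/2))"
    using c by (intro mult_right_mono) auto
  also have "\<dots> = sin x" using sin_double[of "x/2"] by simp
  finally have 1: "x * (cos (x/2))^2 \<le> sin x" by (simp add: power2_eq_square mult_ac)
  have "cos x \<ge> 0" using assms by (intro cos_ge_zero) auto
  then have "(cos (x/2))^2 \<ge> 1/2" using cos_double_cos[of "x/2"] by simp
  then have "x * (cos (x/2))^2 \<ge> x * (1/2)" using assms by (intro mult_left_mono) auto
  with 1 show ?thesis by simp
qed

lemma half_le_sin_min:
  assumes "0 \<le> l" "l \<le> 1" shows "pi * min l (1 - l) / 2 \<le> sin (pi * l)"
proof (cases "l \<le> 1/2")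
  case True
  then show ?thesis using half_le_sin[of "pi*l"] assms by (simp add: min_def)
next
  case False
  have "sin (pi * l) = sin (pi * (1 - l))" using sin_pi_minus[of "pi*l"] by (simp add: algebra_simps)
  then show ?thesis using half_le_sin[of "pi*(1-l)"] assms False by (simp add: min_def)
qed

lemma sinc_pi_abs_le: "\<bar>sinc_pi d\<bar> \<le> 1"
proof -
  have "\<bar>sin (pi*d)\<bar> \<le> \<bar>pi*d\<bar>" by (rule abs_sin_x_le_abs_x)
  then show ?thesis by (auto simp: sinc_pi_def divide_simps abs_mult)
qed

lemma sinc_pi_ge: assumes "\<bar>d\<bar> \<le> 1/2" shows "1/2 \<le> sinc_pi d"
proof -
  have *: "1/2 \<le> sinc_pi d" if "0 < d" "d \<le> 1/2" for d
    using half_le_sin[of "pi*d"] that by (simp add: sinc_pi_def field_simps)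
  have "sinc_pi (-d) = sinc_pi d" by (simp add: sinc_pi_def)
  then show ?thesis using *[of d] *[of "-d"] assms by (cases "d = 0"; cases "d > 0") (auto simp: sinc_pi_def)
qed

lemma abs_cos_diff: "\<bar>cos x - cos y\<bar> \<le> \<bar>x - y :: real\<bar>"
proof -
  have "norm (cos x - cos y) \<le> 1 * norm (x - y)"
    by (rule field_differentiable_bound[of UNIV cos "\<lambda>t. - sin t"])
      (auto intro!: derivative_eq_intros)
  then show ?thesis by simp
qed

text \<open>Written as \<open>\<integral>\<^sub>0\<^sup>1 cos (\<pi> d s) ds\<close>, the function inherits the Lipschitz bound of the cosine. The
  primitive \<open>E d\<close> of the integrand replaces the integral by the mean value inequality and covers
  \<open>d = 0\<close> without a limit.\<close>

lemma sinc_pi_lipschitz: "\<bar>sinc_pi d - sinc_pi d'\<bar> \<le> pi * \<bar>d - d'\<bar>"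
proof -
  define E where "E d s = (if d = 0 then s else sin (pi * d * s)/(pi*d))" for d s :: real
  have E: "(E d has_real_derivative cos (pi * d * s)) (at s within A)" for d s A
    unfolding E_def by (cases "d = 0") (auto intro!: derivative_eq_intros)
  have "norm ((E d 1 - E d' 1) - (E d 0 - E d' 0)) \<le> (pi * \<bar>d - d'\<bar>) * norm (1 - (0::real))"
  proof (rule field_differentiable_bound[of "{0..1}" "\<lambda>s. E d s - E d' s" "\<lambda>s. cos (pi * d * s) - cos (pi * d' * s)"])
    fix s :: real assume s: "s \<in> {0..1}"
    show "((\<lambda>s. E d s - E d' s) has_field_derivative cos (pi * d * s) - cos (pi * d' * s)) (at s within {0..1})"
      by (intro derivative_intros E)
    have "\<bar>cos (pi * d * s) - cos (pi * d' * s)\<bar> \<le> \<bar>pi * d * s - pi * d' * s\<bar>" by (rule abs_cos_diff)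
    also have "pi * d * s - pi * d' * s = s * (pi * (d - d'))" by (simp add: algebra_simps)
    also have "\<bar>\<dots>\<bar> = s * (pi * \<bar>d - d'\<bar>)" using s by (simp add: abs_mult)
    also have "\<dots> \<le> pi * \<bar>d - d'\<bar>" using s by (intro mult_left_le_one_le) auto
    finally show "norm (cos (pi * d * s) - cos (pi * d' * s)) \<le> pi * \<bar>d - d'\<bar>" by simp
  qed auto
  moreover have "E x 1 = sinc_pi x" "E x 0 = 0" for x by (simp_all add: E_def sinc_pi_def)
  ultimately show ?thesis by simp
qed

lemma stretch_abs_le: "\<bar>stretch t d\<bar> \<le> 1/2"
proof -
  have "\<bar>sinc_pi d\<bar> * \<bar>cos (2 * pi * t + pi * d)\<bar> \<le> 1 * 1"
    by (intro mult_mono sinc_pi_abs_le) auto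
  then show ?thesis by (simp add: stretch_def abs_mult)
qed

lemma stretch_lipschitz: "\<bar>stretch t d - stretch t' d'\<bar> \<le> pi * (\<bar>t - t'\<bar> + \<bar>d - d'\<bar>)"
proof -
  let ?c = "cos (2 * pi * t + pi * d)" and ?c' = "cos (2 * pi * t' + pi * d')"
  have "2 * (stretch t d - stretch t' d') = sinc_pi d * (?c - ?c') + (sinc_pi d - sinc_pi d') * ?c'"
    by (simp add: stretch_def algebra_simps)
  also have "\<bar>\<dots>\<bar> \<le> \<bar>sinc_pi d\<bar> * \<bar>?c - ?c'\<bar> + \<bar>sinc_pi d - sinc_pi d'\<bar> * \<bar>?c'\<bar>"
    by (simp flip: abs_mult)
  also have "\<dots> \<le> 1 * \<bar>(2 * pi * t + pi * d) - (2 * pi * t' + pi * d')\<bar> + pi * \<bar>d - d'\<bar> * 1"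
    by (intro add_mono mult_mono sinc_pi_abs_le abs_cos_diff sinc_pi_lipschitz) auto
  also have "(2 * pi * t + pi * d) - (2 * pi * t' + pi * d') = pi * (2 * (t - t') + (d - d'))"
    by (simp add: algebra_simps)
  also have "\<bar>\<dots>\<bar> = pi * \<bar>2 * (t - t') + (d - d')\<bar>" by (simp add: abs_mult)
  also have "\<dots> \<le> pi * (2 * \<bar>t - t'\<bar> + \<bar>d - d'\<bar>)"
    using abs_triangle_ineq[of "2 * (t - t')" "d - d'"]
    by (intro mult_left_mono) (simp_all add: abs_mult del: distrib_left_numeral right_diff_distrib_numeral)
  finally show ?thesis by (simp add: algebra_simps abs_mult)
qed

text \<open>Multiplying by \<open>2 sin (w/2)\<close> makes the sum telescope.\<close>

lemma sum_cos_progression: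
  "(\<Sum>j<n. cos (u + real j * w)) * (2 * sin (w/2)) = sin (u + real n * w - w/2) - sin (u - w/2)"
proof (induction n)
  case (Suc n)
  let ?v = "u + real n * w"
  have "sin (?v + w/2) - sin (?v - w/2) = 2 * cos ?v * sin (w/2)"
    by (simp add: sin_add sin_diff)
  moreover have "u + real (Suc n) * w - w/2 = ?v + w/2" by (simp add: field_simps)
  ultimately show ?case using Suc by (simp add: algebra_simps)
qed simp

lemma sum_cos_full_turns:
  assumes "0 < m" "m < n" shows "(\<Sum>j<n. cos (u + real j * (2 * pi * real m / real n))) = 0"
proof -
  let ?w = "2 * pi * real m / real n"
  have "u + real n * ?w - ?w/2 = (u - ?w/2) + 2 * pi * real m" using assms by (simp add: field_simps)
  moreover have "sin (2 * pi * real m) = 0" "cos (2 * pi * real m) = 1"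
    using sin_2npi[of m] cos_2npi[of m] by (simp_all add: mult_ac)
  ultimately have "sin (u + real n * ?w - ?w/2) = sin (u - ?w/2)"
    by (simp only: sin_add mult_1_right mult_zero_right add_0_right)
  moreover have "sin (?w/2) > 0" using assms by (intro sin_gt_zero) (auto simp: field_simps)
  ultimately show ?thesis using sum_cos_progression[where u=u and w="?w" and n=n] by simp
qed

text \<open>A quantitative form of concavity at \<open>1\<close>. The quadratic term is what survives averaging when the
  mean of \<open>u\<close> vanishes.\<close>

lemma sqrt_one_plus_le: assumes "\<bar>u\<bar> \<le> 1" shows "sqrt (1 + u) \<le> 1 + u/2 - u^2/16"
proof (rule real_le_lsqrt)
  have "u^2 \<le> 1" using assms by (simp add: abs_square_le_1)
  then show "0 \<le> 1 + u/2 - u^2/16" using assms by (simp add: abs_le_iff)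
  have "0 \<le> u^2 * ((1/8) * (1 - u/2)) + (u^2)^2/256" using assms by (intro add_nonneg_nonneg mult_nonneg_nonneg) (auto simp: abs_le_iff)
  also have "\<dots> = (1 + u/2 - u^2/16)^2 - (1 + u)" by (simp add: power2_eq_square field_simps)
  finally show "1 + u \<le> (1 + u/2 - u^2/16)^2" by simp
qed

text \<open>The linear term of \<open>sqrt_one_plus_le\<close> averages to \<open>0\<close> and the squared cosine to \<open>1/2\<close>, which leaves
  \<open>1 - (sinc_pi d)\<^sup>2/128\<close>. Arcs of length at most \<open>1/2\<close> have \<open>sinc_pi d \<ge> 1/2\<close>, so the gain is uniform
  even for infinitesimally short arcs.\<close>

lemma average_sqrt_stretch:
  assumes "3 \<le> n" "\<bar>d\<bar> \<le> 1/2"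
  shows "(\<Sum>j<n. sqrt (1 + stretch (t + real j / real n) d)) \<le> real n * (1 - 1/512)"
proof -
  let ?s = "\<lambda>j. stretch (t + real j / real n) d"
  let ?u = "2 * pi * t + pi * d"
  have arg: "2 * pi * (t + real j / real n) + pi * d = ?u + real j * (2 * pi * real 1 / real n)" for j
    by (simp add: field_simps)
  have s: "?s j = sinc_pi d / 2 * cos (?u + real j * (2 * pi * real 1 / real n))" for j
    unfolding stretch_def arg by simp
  have sum1: "(\<Sum>j<n. ?s j) = 0"
    unfolding s sum_distrib_left[symmetric] using sum_cos_full_turns[of 1 n ?u] assms by simp
  have sq: "(?s j)^2 = (sinc_pi d)^2/8 * (1 + cos (2 * ?u + real j * (2 * pi * real 2 / real n)))" for j
  proof -
    let ?v = "?u + real j * (2 * pi * real 1 / real n)"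
    have "2 * ?v = 2 * ?u + real j * (2 * pi * real 2 / real n)" by (simp add: field_simps)
    moreover have "(cos ?v)^2 = (1 + cos (2 * ?v))/2" unfolding cos_double_cos by simp
    ultimately have "(cos ?v)^2 = (1 + cos (2 * ?u + real j * (2 * pi * real 2 / real n)))/2" by (simp only:)
    then show ?thesis unfolding s power_mult_distrib by (simp only:) (simp add: power_divide)
  qed
  have sum2: "(\<Sum>j<n. (?s j)^2) = (sinc_pi d)^2/8 * real n"
    unfolding sq sum_distrib_left[symmetric] sum.distrib
    using sum_cos_full_turns[of 2 n "2 * ?u"] assms by simp
  have "(\<Sum>j<n. sqrt (1 + ?s j)) \<le> (\<Sum>j<n. 1 + ?s j/2 - (?s j)^2/16)"
    by (intro sum_mono sqrt_one_plus_le order.trans[OF stretch_abs_le]) simp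
  also have "\<dots> = real n - (sinc_pi d)^2/128 * real n"
    using sum1 sum2 by (simp add: sum.distrib sum_subtractf flip: sum_divide_distrib)
  also have "\<dots> \<le> real n * (1 - 1/512)"
  proof -
    have "(1/2)^2 \<le> (sinc_pi d)^2" using sinc_pi_ge[OF assms(2)] by (intro power_mono) auto
    then have "(1/512) * real n \<le> (sinc_pi d)^2/128 * real n" by (intro mult_right_mono) (auto simp: power2_eq_square)
    then show ?thesis by (simp add: algebra_simps)
  qed
  finally show ?thesis .
qed

section \<open>Lifts of maps close to the model\<close>

abbreviation cdist :: "real \<Rightarrow> real \<Rightarrow> real"
  where "cdist u v \<equiv> dist (to_circle u) (to_circle v)"

lemma to_circle_add_int [simp]: "to_circle (x + of_int m) = to_circle x"
  by (simp add: to_circle_eq_iff)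

lemma to_circle_diff_int [simp]: "to_circle (x - of_int m) = to_circle x"
  by (simp add: to_circle_eq_iff)

text \<open>An arc slightly longer than a half circle is not the shortest one between its endpoints, but nearly
  so. The loss is a factor close to \<open>1\<close>, which lets an arc keep its lift while its length moves across
  \<open>1/2\<close>.\<close>

lemma abs_diff_le_cdist:
  assumes "\<bar>x - y\<bar> \<le> 1/2 + 2 * s" "0 \<le> s" "s \<le> 1/100"
  shows "\<bar>x - y\<bar> \<le> (1 + 16 * s) * cdist x y"
proof -
  let ?d = "x - y" and ?n = "round (x - y)"
  have "\<bar>?d\<bar> \<le> (1 + 16 * s) * \<bar>?d - of_int ?n\<bar>"
  proof (cases "?n = 0")
    case True
    have "1 * \<bar>?d\<bar> \<le> (1 + 16 * s) * \<bar>?d\<bar>" using assms by (intro mult_right_mono) auto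
    then show ?thesis using True by simp
  next
    case False
    then have "1 \<le> \<bar>of_int ?n :: real\<bar>" by linarith
    then have 1: "1/2 - 2 * s \<le> \<bar>?d - of_int ?n\<bar>" using assms(1) by linarith
    have "s * s \<le> s * (1/100)" using assms by (intro mult_left_mono) auto
    then have "1/2 + 2 * s \<le> (1 + 16 * s) * (1/2 - 2 * s)" using assms by (simp add: algebra_simps)
    also have "\<dots> \<le> (1 + 16 * s) * \<bar>?d - of_int ?n\<bar>" using 1 assms by (intro mult_left_mono) auto
    finally show ?thesis using assms(1) by linarith
  qed
  then show ?thesis by (simp add: dist_to_circle)
qed

text \<open>Fibre component of the \<open>n\<close>-th iterate of \<open>(y, x) \<mapsto> (b y, B y x)\<close>. The first step is split off
  first, which matches inductions that apply the hypothesis to the images of curves.\<close>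

primrec fiber :: "(real \<Rightarrow> real) \<Rightarrow> (real \<Rightarrow> real \<Rightarrow> real) \<Rightarrow> nat \<Rightarrow> real \<Rightarrow> real \<Rightarrow> real"
  where
    "fiber b B 0 = (\<lambda>y x. x)"
  | "fiber b B (Suc n) = (\<lambda>y x. fiber b B n (b y) (B y x))"

lemma fiber_add: "fiber b B (m + n) y x = fiber b B n ((b ^^ m) y) (fiber b B m y x)"
  by (induction m arbitrary: y x) (simp_all add: funpow_swap1)

text \<open>The lift \<open>(y, x) \<mapsto> (b y, B y x)\<close> of a map near the model. The constants only have to be small
  (\<open>e\<close>) and large (\<open>N\<close>) compared with the gain \<open>1/512\<close> of \<open>average_sqrt_stretch\<close>. Comparing
  \<open>B y\<close> with the model up to an \<open>e\<close>-Lipschitz error is the form of \<open>C\<^sup>1\<close>-closeness in the fibre that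
  controls relative lengths of arcs, however short.\<close>

locale forced_lift =
  fixes b b' :: "real \<Rightarrow> real" and B :: "real \<Rightarrow> real \<Rightarrow> real" and N :: nat and e :: real
  assumes N: "1000000 \<le> N"
    and e: "0 \<le> e" "e \<le> 1/1000000"
    and b_deriv: "(b has_real_derivative b' y) (at y)"
    and b'_close: "\<bar>b' y - real N\<bar> \<le> e"
    and b_per: "b (y + 1) = b y + real N"
    and B_per_x: "B y (x + 1) = B y x + 1"
    and B_per_y: "B (y + 1) x = B y x"
    and B_close_x: "\<bar>(B y x2 - x2 - wobble (x2 + y)) - (B y x1 - x1 - wobble (x1 + y))\<bar> \<le> e * \<bar>x2 - x1\<bar>"
    and B_lip_y: "\<bar>B y x - B y' x\<bar> \<le> 3/4 * \<bar>y - y'\<bar>"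
begin

lemma B_int_x: "B y (x + of_int m) = B y x + of_int m"
proof -
  have *: "B y (x + of_nat n) = B y x + of_nat n" for n x
  proof (induction n)
    case (Suc n)
    then show ?case using B_per_x[of y "x + of_nat n"] by (simp add: add_ac)
  qed simp
  show ?thesis
    using *[of x "nat m"] *[of "x + of_int m" "nat (- m)"] by (cases "0 \<le> m") auto
qed

lemma B_int_y: "B (y + of_int m) x = B y x"
proof -
  have *: "B (y + of_nat n) x = B y x" for n y
  proof (induction n)
    case (Suc n)
    then show ?case using B_per_y[of "y + of_nat n" x] by (simp add: add_ac)
  qed simp
  show ?thesis
    using *[of y "nat m"] *[of "y + of_int m" "nat (- m)"] by (cases "0 \<le> m") auto
qed

lemma b_int: "b (y + of_int m) = b y + of_int (m * int N)"
proof -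
  have *: "b (y + of_nat n) = b y + of_nat n * real N" for n y
  proof (induction n)
    case (Suc n)
    then show ?case using b_per[of "y + of_nat n"] by (simp add: algebra_simps)
  qed simp
  show ?thesis
    using *[of y "nat m"] *[of "y + of_int m" "nat (- m)"] by (cases "0 \<le> m") auto
qed

lemma B_diff: "\<bar>B y x2 - B y x1 - (x2 - x1) * (1 + stretch (x1 + y) (x2 - x1))\<bar> \<le> e * \<bar>x2 - x1\<bar>"
  using B_close_x[of y x2 x1] wobble_diff_stretch[of "x1 + y" "x2 - x1"]
  by (simp add: algebra_simps)

lemma B_abs_diff: "\<bar>B y x2 - B y x1\<bar> \<le> \<bar>x2 - x1\<bar> * (1 + stretch (x1 + y) (x2 - x1) + e)"
proof -
  have "0 \<le> 1 + stretch (x1 + y) (x2 - x1)" using stretch_abs_le[of "x1 + y" "x2 - x1"] by linarith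
  then have "\<bar>(x2 - x1) * (1 + stretch (x1 + y) (x2 - x1))\<bar> = \<bar>x2 - x1\<bar> * (1 + stretch (x1 + y) (x2 - x1))"
    by (simp add: abs_mult)
  then show ?thesis using B_diff[of y x2 x1] by (simp add: algebra_simps)
qed

lemma B_lip_x: "\<bar>B y x2 - B y x1\<bar> \<le> 2 * \<bar>x2 - x1\<bar>"
proof -
  have "\<bar>x2 - x1\<bar> * (1 + stretch (x1 + y) (x2 - x1) + e) \<le> \<bar>x2 - x1\<bar> * 2"
    using stretch_abs_le[of "x1 + y" "x2 - x1"] e by (intro mult_left_mono) auto
  then show ?thesis using B_abs_diff[of y x2 x1] by simp
qed

lemma B_expand: assumes "x1 \<le> x2" shows "(x2 - x1) / 4 \<le> B y x2 - B y x1"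
proof -
  have "(x2 - x1) * (1/2) \<le> (x2 - x1) * (1 + stretch (x1 + y) (x2 - x1))"
    using assms stretch_abs_le[of "x1 + y" "x2 - x1"] by (intro mult_left_mono) (simp_all only: abs_le_iff, linarith+)
  moreover have "e * (x2 - x1) \<le> 1/4 * (x2 - x1)" using e assms by (intro mult_right_mono) auto
  moreover have "(x2 - x1) * (1 + stretch (x1 + y) (x2 - x1)) - e * (x2 - x1) \<le> B y x2 - B y x1"
    using B_diff[of y x2 x1] assms by (simp only: abs_le_iff abs_of_nonneg diff_ge_0_iff_ge) linarith
  ultimately show ?thesis by linarith
qed

lemma B_lip: "\<bar>B y x - B y' x'\<bar> \<le> 3/4 * \<bar>y - y'\<bar> + 2 * \<bar>x - x'\<bar>"
  using B_lip_y[of y x y'] B_lip_x[of y' x x'] by linarith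

lemma b_close:
  assumes "y \<le> y'" shows "\<bar>b y' - b y - real N * (y' - y)\<bar> \<le> e * (y' - y)"
proof (cases "y = y'")
  case False
  with assms have "y < y'" by simp
  then obtain z where z: "b y' - b y = (y' - y) * b' z"
    using MVT2[of y y' b b'] b_deriv by auto
  then have "b y' - b y - real N * (y' - y) = (b' z - real N) * (y' - y)" by (simp add: algebra_simps)
  then show ?thesis using assms b'_close[of z] by (simp add: abs_mult mult_right_mono)
qed simp

lemma b_expand: assumes "y \<le> y'" shows "(real N - 1) * (y' - y) \<le> b y' - b y"
proof -
  have "e * (y' - y) \<le> 1 * (y' - y)" using assms e by (intro mult_right_mono) auto
  then show ?thesis using b_close[OF assms] by (simp add: algebra_simps abs_le_iff)
qed

lemma b_expand_abs: "(real N - 1) * \<bar>y' - y\<bar> \<le> \<bar>b y' - b y\<bar>"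
  using b_expand[of y y'] b_expand[of y' y] by (cases "y \<le> y'") auto

lemma b_strict: "y < y' \<Longrightarrow> b y < b y'"
proof -
  assume "y < y'"
  then have "0 < (real N - 1) * (y' - y)" using N by simp
  then show "b y < b y'" using b_expand[of y y'] \<open>y < y'\<close> by linarith
qed

lemma b_le_iff: "b y \<le> b y' \<longleftrightarrow> y \<le> y'"
  using b_strict[of y y'] b_strict[of y' y] by (cases y y' rule: linorder_cases) auto

lemma b_cont: "continuous_on S b"
  by (meson DERIV_continuous_on b_deriv has_field_derivative_at_within)

lemma b_surj: obtains y where "b y = z"
proof -
  define m where "m = \<bar>z - b 0\<bar>"
  have "1 * m \<le> (real N - 1) * m" using N by (intro mult_right_mono) (auto simp: m_def)
  then have "b (- m) \<le> z" "z \<le> b m"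
    using b_expand[of 0 m] b_expand[of "-m" 0] by (auto simp: m_def)
  then have "\<exists>y. - m \<le> y \<and> y \<le> m \<and> b y = z"
    by (intro IVT') (auto simp: m_def b_cont)
  then show ?thesis using that by blast
qed

lemma B_cont_joint: "continuous_on S (\<lambda>p. B (fst p) (snd p))"
proof (rule continuous_on_subset[of UNIV])
  have "4-lipschitz_on UNIV (\<lambda>p. B (fst p) (snd p))"
  proof (rule lipschitz_onI)
    fix p q :: "real \<times> real"
    have "dist (B (fst p) (snd p)) (B (fst q) (snd q)) \<le> 3/4 * dist (fst p) (fst q) + 2 * dist (snd p) (snd q)"
      unfolding dist_real_def by (rule B_lip)
    then show "dist (B (fst p) (snd p)) (B (fst q) (snd q)) \<le> 4 * dist p q"
      using dist_fst_le[of p q] dist_snd_le[of p q] zero_le_dist[of p q] by linarith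
  qed simp
  then show "continuous_on UNIV (\<lambda>p. B (fst p) (snd p))" by (rule lipschitz_on_continuous_on)
qed simp

abbreviation "\<Phi> \<equiv> fiber b B"

lemma fiber_cont_joint: "continuous_on UNIV (\<lambda>p. \<Phi> n (fst p) (snd p))"
proof (induction n)
  case 0
  show ?case by (simp add: continuous_on_snd)
next
  case (Suc n)
  have "continuous_on UNIV (\<lambda>p. (b (fst p), B (fst p) (snd p)) :: real \<times> real)"
    by (intro continuous_on_Pair B_cont_joint continuous_on_compose2[OF b_cont[of UNIV]] continuous_on_fst) auto
  from continuous_on_compose2[OF Suc this] show ?case by simp
qed

lemma fiber_cont:
  "continuous_on S f \<Longrightarrow> continuous_on S g \<Longrightarrow> continuous_on S (\<lambda>t. \<Phi> n (f t) (g t))"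
  using continuous_on_compose2[OF fiber_cont_joint, of S "\<lambda>t. (f t, g t)"]
  by (simp add: continuous_on_Pair)

lemma fiber_int_x: "\<Phi> n y (x + of_int m) = \<Phi> n y x + of_int m"
  by (induction n arbitrary: y x) (simp_all add: B_int_x)

lemma fiber_int_y: "\<Phi> n (y + of_int m) x = \<Phi> n y x"
  by (induction n arbitrary: y x m) (simp_all add: B_int_y b_int del: of_int_mult)

lemma fiber_strict_mono: "x < x' \<Longrightarrow> \<Phi> n y x < \<Phi> n y x'"
proof (induction n arbitrary: y x x')
  case (Suc n)
  have "(x' - x) / 4 \<le> B y x' - B y x" using Suc.prems by (intro B_expand) simp
  then have "B y x < B y x'" using Suc.prems by simp
  then show ?case using Suc.IH by simp
qed simp

text \<open>Any slope bound between \<open>1/N\<close> and the contraction gain would do. The bound \<open>10\<^sup>-\<^sup>5\<close> is invariant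
  because the new slope is at most \<open>(3/4 + 2 \<cdot> 10\<^sup>-\<^sup>5) / (N - 1)\<close>.\<close>

definition almost_horizontal :: "real \<Rightarrow> (real \<Rightarrow> real) \<Rightarrow> bool"
  where "almost_horizontal c X \<longleftrightarrow> (\<forall>y\<in>{c..c+1}. \<forall>y'\<in>{c..c+1}. \<bar>X y - X y'\<bar> \<le> \<bar>y - y'\<bar> / 100000)"

lemma image_almost_horizontal:
  assumes "almost_horizontal c X" "y \<in> {c..c+1}" "y' \<in> {c..c+1}"
  shows "\<bar>B y (X y) - B y' (X y')\<bar> \<le> \<bar>b y - b y'\<bar> / 100000"
proof -
  have "\<bar>B y (X y) - B y' (X y')\<bar> \<le> 3/4 * \<bar>y - y'\<bar> + 2 * \<bar>X y - X y'\<bar>" by (rule B_lip)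
  also have "\<bar>X y - X y'\<bar> \<le> \<bar>y - y'\<bar> / 100000" using assms by (auto simp: almost_horizontal_def)
  also have "3/4 * \<bar>y - y'\<bar> + 2 * (\<bar>y - y'\<bar> / 100000) \<le> (real N - 1) * \<bar>y - y'\<bar> / 100000"
  proof -
    have "999999 * \<bar>y - y'\<bar> \<le> (real N - 1) * \<bar>y - y'\<bar>" using N by (intro mult_right_mono) auto
    moreover have "3/4 * A + 2 * (A / 100000) \<le> K / 100000" if "0 \<le> A" "999999 * A \<le> K" for A K :: real
      using that by linarith
    ultimately show ?thesis using abs_ge_zero by blast
  qed
  also have "\<dots> \<le> \<bar>b y - b y'\<bar> / 100000" using b_expand_abs[of y y'] by (simp add: divide_right_mono)
  finally show ?thesis by simp
qed

text \<open>During one step the arc between two almost horizontal curves has almost constant position and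
  length, and the \<open>j\<close>-th piece of the base lies near \<open>c + j/N\<close>. So the stretch may be evaluated at the
  left endpoint \<open>c\<close> with the phase moved by \<open>j/N\<close>. The error \<open>1/2000\<close> absorbs this freezing, the
  distance to the model and the factor of \<open>abs_diff_le_cdist\<close>.\<close>

lemma one_step_contraction:
  assumes X: "almost_horizontal c X" "almost_horizontal c X'"
    and d: "\<bar>X' c - X c\<bar> \<le> 1/2"
    and y: "y \<in> {c..c+1}" and j: "b c + real j \<le> b y" "b y \<le> b c + real j + 1"
  shows "cdist (B y (X y)) (B y (X' y))
    \<le> cdist (X y) (X' y) * (1 + stretch (X c + c + real j / real N) (X' c - X c) + 1/2000)"
proof -
  let ?V = "stretch (X y + y) (X' y - X y)" and ?W = "stretch (X c + c + real j / real N) (X' c - X c)"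
  have N': "real N \<ge> 1000000" using N by simp
  have Xc: "\<bar>X y - X c\<bar> \<le> 1/100000" "\<bar>X' y - X' c\<bar> \<le> 1/100000"
  proof -
    have "\<bar>X y - X c\<bar> \<le> \<bar>y - c\<bar>/100000" "\<bar>X' y - X' c\<bar> \<le> \<bar>y - c\<bar>/100000"
      using X y unfolding almost_horizontal_def by (metis atLeastAtMost_iff le_add_same_cancel1 order.refl zero_le_one)+
    then show "\<bar>X y - X c\<bar> \<le> 1/100000" "\<bar>X' y - X' c\<bar> \<le> 1/100000" using y by auto
  qed
  have yj: "\<bar>y - c - real j / real N\<bar> \<le> 1/100000"
  proof -
    have "e * (y - c) \<le> 1 * 1" using e y by (intro mult_mono) auto
    then have "\<bar>real N * (y - c) - real j\<bar> \<le> 2" using b_close[of c y] j y by auto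
    moreover have "real N * (y - c) - real j = real N * (y - c - real j / real N)" using N' by (simp add: field_simps)
    ultimately have "real N * \<bar>y - c - real j / real N\<bar> \<le> 2" by (simp add: abs_mult)
    moreover have "1000000 * \<bar>y - c - real j / real N\<bar> \<le> real N * \<bar>y - c - real j / real N\<bar>"
      using N' by (intro mult_right_mono) auto
    ultimately have "1000000 * \<bar>y - c - real j / real N\<bar> \<le> 2" by (rule order.trans[rotated])
    then show ?thesis by simp
  qed
  have "\<bar>?V - ?W\<bar> \<le> pi * (\<bar>(X y + y) - (X c + c + real j / real N)\<bar> + \<bar>(X' y - X y) - (X' c - X c)\<bar>)"
    by (rule stretch_lipschitz)
  also have "\<dots> \<le> 4 * (2/100000 + 2/100000)"
  proof (intro mult_mono add_mono)
    show "\<bar>(X y + y) - (X c + c + real j / real N)\<bar> \<le> 2/100000" using Xc yj by linarith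
    show "\<bar>(X' y - X y) - (X' c - X c)\<bar> \<le> 2/100000" using Xc by linarith
  qed (use pi_less_4 in auto)
  finally have "?V - ?W \<le> 4 * (2/100000 + 2/100000)" by (rule order.trans[OF abs_ge_self])
  then have V: "?V \<le> ?W + 16/100000" by simp
  have dd: "\<bar>X y - X' y\<bar> \<le> (1 + 16 * (1/100000)) * cdist (X y) (X' y)"
  proof (rule abs_diff_le_cdist)
    show "\<bar>X y - X' y\<bar> \<le> 1/2 + 2 * (1/100000)" using Xc d by linarith
  qed auto
  have V0: "\<bar>?W\<bar> \<le> 1/2" "\<bar>?V\<bar> \<le> 1/2" by (rule stretch_abs_le)+
  have "cdist (B y (X y)) (B y (X' y)) \<le> \<bar>B y (X' y) - B y (X y)\<bar>"
    using dist_to_circle_le[of "B y (X y)" "B y (X' y)"] by (simp add: dist_real_def abs_minus_commute)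
  also have "\<dots> \<le> \<bar>X' y - X y\<bar> * (1 + ?V + e)" by (rule B_abs_diff)
  also have "\<dots> \<le> ((1 + 16 * (1/100000)) * cdist (X y) (X' y)) * (1 + ?W + 17/100000)"
    using dd V V0 e by (intro mult_mono) (auto simp: abs_minus_commute)
  also have "\<dots> = cdist (X y) (X' y) * ((1 + 16/100000) * (1 + ?W + 17/100000))" by simp
  also have "\<dots> \<le> cdist (X y) (X' y) * (1 + ?W + 1/2000)"
    using V0 by (intro mult_left_mono) (auto simp: algebra_simps)
  finally show ?thesis .
qed

end

section \<open>Synchronization over almost every base point\<close>

lemma integral_split_unit:
  fixes f :: "real \<Rightarrow> real"
  assumes "continuous_on {p..p + real n} f"
  shows "integral {p..p + real n} f = (\<Sum>j<n. integral {p + real j..p + real j + 1} f)"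
  using assms
proof (induction n)
  case (Suc n)
  have "f integrable_on {p..p + real (Suc n)}" by (rule integrable_continuous_real[OF Suc.prems])
  then have "integral {p..p + real n} f + integral {p + real n..p + real (Suc n)} f
      = integral {p..p + real (Suc n)} f"
    by (intro Henstock_Kurzweil_Integration.integral_combine) auto
  moreover have "continuous_on {p..p + real n} f" by (rule continuous_on_subset[OF Suc.prems]) auto
  moreover have "p + real (Suc n) = p + real n + 1" by simp
  ultimately show ?case using Suc.IH by (simp add: algebra_simps)
qed simp

lemma sqrt_add_le: assumes "1/4 \<le> v" "0 \<le> h" shows "sqrt (v + h) \<le> sqrt v + h"
proof (rule real_le_lsqrt)
  have "1/2 \<le> sqrt v" using assms real_le_rsqrt[of "1/2" v] by (simp add: power2_eq_square)
  then have "h * 1 \<le> h * (2 * sqrt v)" using assms by (intro mult_left_mono) auto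
  then show "v + h \<le> (sqrt v + h)\<^sup>2" using assms by (simp add: power2_sum algebra_simps add_increasing)
qed (use assms in simp)

context forced_lift begin

text \<open>The right-hand side leaves room to divide by \<open>N - e\<close>, the least expansion of the base.\<close>

lemma sum_contraction_factors:
  assumes "\<bar>d\<bar> \<le> 1/2"
  shows "(\<Sum>j<N. sqrt (1 + stretch (t + real j / real N) d + 1/2000)) \<le> 999/1000 * (real N - e)"
proof -
  have "(\<Sum>j<N. sqrt (1 + stretch (t + real j / real N) d + 1/2000))
      \<le> (\<Sum>j<N. sqrt (1 + stretch (t + real j / real N) d) + 1/2000)"
  proof (intro sum_mono sqrt_add_le)
    fix j show "1/4 \<le> 1 + stretch (t + real j / real N) d"
      using stretch_abs_le[of "t + real j / real N" d] by linarith
  qed simp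
  also have "\<dots> = (\<Sum>j<N. sqrt (1 + stretch (t + real j / real N) d)) + real N / 2000"
    by (simp add: sum.distrib)
  also have "\<dots> \<le> real N * (1 - 1/512) + real N / 2000"
    using average_sqrt_stretch[of N d t] N assms by simp
  also have "\<dots> \<le> 999/1000 * (real N - e)"
    using N e by simp
  finally show ?thesis .
qed

text \<open>Induction on \<open>n\<close> for all pairs of almost horizontal curves. Substituting \<open>z = b y\<close> maps the unit
  interval onto \<open>N\<close> unit intervals and costs a factor at most \<open>1/(N - e)\<close>. On the \<open>j\<close>-th of them the
  image curves are again almost horizontal, with supremal distance \<open>D\<close> multiplied by the \<open>j\<close>-th
  stretch, and the sum of the square roots of these stretches is at most \<open>999/1000 \<cdot> (N - e)\<close>.
  Bounding by suprema rather than by integrals of the distance avoids any comparison of the distance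
  at different points of one curve.\<close>

lemma average_contraction:
  assumes "almost_horizontal c X" "almost_horizontal c X'" and D: "\<And>y. y \<in> {c..c+1} \<Longrightarrow> cdist (X y) (X' y) \<le> D"
  shows "integral {c..c+1} (\<lambda>y. sqrt (cdist (\<Phi> n y (X y)) (\<Phi> n y (X' y)))) \<le> (999/1000)^n * sqrt D"
  using assms
proof (induction n arbitrary: c X X' D)
  case 0
  have "continuous_on {c..c+1} X" if "almost_horizontal c X" for X
    by (rule lipschitz_on_continuous_on[of "1/100000"], rule lipschitz_onI)
       (use that in \<open>auto simp: almost_horizontal_def dist_real_def\<close>)
  then have "continuous_on {c..c+1} (\<lambda>y. sqrt (cdist (X y) (X' y)))"
    using 0 by (intro continuous_on_real_sqrt continuous_on_dist continuous_on_compose2[OF continuous_on_to_circle[of UNIV]]) auto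
  then have "integral {c..c+1} (\<lambda>y. sqrt (cdist (X y) (X' y))) \<le> integral {c..c+1} (\<lambda>y. sqrt D)"
    using 0 by (intro integral_le integrable_continuous_real) auto
  then show ?case by simp
next
  case (Suc n)
  \<comment> \<open>Existence and uniqueness of the preimage hold because \<open>b\<close> is an increasing bijection of the line.\<close>
  define \<tau> where "\<tau> z = (THE y. b y = z)" for z
  have \<tau>b: "\<tau> (b y) = y" for y
    unfolding \<tau>_def by (rule the_equality) (simp_all add: order.eq_iff b_le_iff)
  have b\<tau>: "b (\<tau> z) = z" for z
    using b_surj[of z] \<tau>b by metis
  \<comment> \<open>Another lift of the second curve makes the arc at \<open>c\<close> at most a half circle, where the gain is uniform.\<close>
  define m where "m = round (X' c - X c)"
  define Xr where "Xr y = X' y - of_int m" for y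
  have Xr: "almost_horizontal c Xr" using Suc.prems(2) by (simp add: almost_horizontal_def Xr_def)
  have d0: "\<bar>Xr c - X c\<bar> \<le> 1/2"
    using of_int_round_abs_le[of "X' c - X c"] unfolding Xr_def m_def by linarith
  define Y where "Y z = B (\<tau> z) (X (\<tau> z))" for z
  define Y' where "Y' z = B (\<tau> z) (Xr (\<tau> z))" for z
  define \<psi> where "\<psi> z = sqrt (cdist (\<Phi> n z (Y z)) (\<Phi> n z (Y' z)))" for z
  define F where "F y = sqrt (cdist (\<Phi> (Suc n) y (X y)) (\<Phi> (Suc n) y (X' y)))" for y
  define v where "v j = stretch (X c + c + real j / real N) (Xr c - X c)" for j
  have bc1: "b (c + 1) = b c + real N" by (rule b_per)
  have \<tau>_in: "\<tau> z \<in> {c..c+1}" if "z \<in> {b c..b c + real N}" for z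
    using that b_le_iff[of c "\<tau> z"] b_le_iff[of "\<tau> z" "c+1"] b\<tau> bc1 by auto
  have Y_lip: "\<bar>Y z - Y z'\<bar> \<le> \<bar>z - z'\<bar> / 100000" "\<bar>Y' z - Y' z'\<bar> \<le> \<bar>z - z'\<bar> / 100000"
    if "z \<in> {b c..b c + real N}" "z' \<in> {b c..b c + real N}" for z z'
    using image_almost_horizontal[OF Suc.prems(1) \<tau>_in[OF that(1)] \<tau>_in[OF that(2)]]
      image_almost_horizontal[OF Xr \<tau>_in[OF that(1)] \<tau>_in[OF that(2)]] by (simp_all add: Y_def Y'_def b\<tau>)
  have Y_flat: "almost_horizontal (b c + real j) Y" "almost_horizontal (b c + real j) Y'" if "j < N" for j
  proof -
    have "real j + 1 \<le> real N" using that by linarith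
    then have "z \<in> {b c..b c + real N}" if "z \<in> {b c + real j..b c + real j + 1}" for z
      using that by auto
    then show "almost_horizontal (b c + real j) Y" "almost_horizontal (b c + real j) Y'"
      unfolding almost_horizontal_def using Y_lip by blast+
  qed
  have Y_cont: "continuous_on {b c..b c + real N} Y" "continuous_on {b c..b c + real N} Y'"
    using Y_lip by (auto intro!: lipschitz_on_continuous_on[of "1/100000"] lipschitz_onI simp: dist_real_def)
  have \<psi>_cont: "continuous_on {b c..b c + real N} \<psi>"
    unfolding \<psi>_def
    by (intro continuous_on_real_sqrt continuous_on_dist continuous_on_compose2[OF continuous_on_to_circle[of UNIV]]
        fiber_cont Y_cont continuous_on_id) auto
  have F_eq: "F y = \<psi> (b y)" for y
  proof -
    have "X' y = Xr y + of_int m" by (simp add: Xr_def)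
    then have "\<Phi> (Suc n) y (X' y) = \<Phi> (Suc n) y (Xr y) + of_int m" by (simp only: fiber_int_x)
    then have "F y = sqrt (cdist (\<Phi> (Suc n) y (X y)) (\<Phi> (Suc n) y (Xr y)))" by (simp add: F_def del: fiber.simps)
    then show ?thesis by (simp add: \<psi>_def Y_def Y'_def \<tau>b)
  qed
  have cd: "cdist (X y) (Xr y) \<le> D" if "y \<in> {c..c+1}" for y
    using Suc.prems(3)[OF that] by (simp add: Xr_def)
  have D0: "0 \<le> D" by (rule order.trans[OF zero_le_dist cd[of c]]) simp
  have piece: "integral {b c + real j..b c + real j + 1} \<psi>
      \<le> (999/1000)^n * sqrt D * sqrt (1 + v j + 1/2000)" if "j < N" for j
  proof -
    have "cdist (Y z) (Y' z) \<le> D * (1 + v j + 1/2000)" if z: "z \<in> {b c + real j..b c + real j + 1}" for z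
    proof -
      have "real j + 1 \<le> real N" using \<open>j < N\<close> by linarith
      then have zy: "\<tau> z \<in> {c..c+1}" using z by (intro \<tau>_in) auto
      have "cdist (Y z) (Y' z) \<le> cdist (X (\<tau> z)) (Xr (\<tau> z)) * (1 + v j + 1/2000)"
        unfolding Y_def Y'_def v_def
        using z by (intro one_step_contraction[OF Suc.prems(1) Xr d0 zy]) (auto simp: b\<tau>)
      also have "\<dots> \<le> D * (1 + v j + 1/2000)"
        using stretch_abs_le[of "X c + c + real j / real N" "Xr c - X c"] cd[OF zy]
        by (intro mult_right_mono) (auto simp: v_def abs_le_iff)
      finally show ?thesis .
    qed
    then have "integral {b c + real j..b c + real j + 1} \<psi> \<le> (999/1000)^n * sqrt (D * (1 + v j + 1/2000))"
      unfolding \<psi>_def using Y_flat[OF that] by (intro Suc.IH) auto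
    then show ?thesis by (simp add: real_sqrt_mult mult.assoc)
  qed
  have int: "integral {b c..b c + real N} \<psi> \<le> (real N - e) * ((999/1000)^Suc n * sqrt D)"
  proof -
    have "integral {b c..b c + real N} \<psi> \<le> (\<Sum>j<N. (999/1000)^n * sqrt D * sqrt (1 + v j + 1/2000))"
      unfolding integral_split_unit[OF \<psi>_cont] using piece by (intro sum_mono) auto
    also have "\<dots> = (999/1000)^n * sqrt D * (\<Sum>j<N. sqrt (1 + v j + 1/2000))"
      by (simp add: sum_distrib_left)
    also have "\<dots> \<le> (999/1000)^n * sqrt D * (999/1000 * (real N - e))"
      unfolding v_def using D0 by (intro mult_left_mono sum_contraction_factors d0) auto
    finally show ?thesis by (simp add: algebra_simps)
  qed
  have subst: "((\<lambda>y. b' y *\<^sub>R \<psi> (b y)) has_integral integral {b c..b (c + 1)} \<psi>) {c..c+1}"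
  proof (rule has_integral_substitution)
    show "b ` {c..c + 1} \<subseteq> {b c..b c + real N}" by (auto simp: b_le_iff simp flip: bc1)
    show "(b has_real_derivative b' x) (at x within {c..c + 1})" for x
      using b_deriv has_field_derivative_at_within by blast
  qed (use b_le_iff \<psi>_cont in auto)
  have F_int: "F integrable_on {c..c+1}"
    unfolding F_eq
    by (intro integrable_continuous_real continuous_on_compose2[OF \<psi>_cont b_cont]) (auto simp: b_le_iff simp flip: bc1)
  have "(real N - e) * integral {c..c+1} F = integral {c..c+1} (\<lambda>y. (real N - e) * F y)" by simp
  also have "\<dots> \<le> integral {c..c+1} (\<lambda>y. b' y *\<^sub>R \<psi> (b y))"
  proof (rule integral_le)
    show "(\<lambda>y. (real N - e) * F y) integrable_on {c..c + 1}" using F_int by (rule integrable_on_mult_right)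
    show "(\<lambda>y. b' y *\<^sub>R \<psi> (b y)) integrable_on {c..c + 1}" using subst by blast
    fix y
    have "0 \<le> \<psi> (b y)" by (simp add: \<psi>_def)
    then show "(real N - e) * F y \<le> b' y *\<^sub>R \<psi> (b y)"
      unfolding F_eq using b'_close[of y] by (simp add: mult_right_mono abs_le_iff)
  qed
  also have "\<dots> = integral {b c..b c + real N} \<psi>" using subst bc1 by (simp add: integral_unique)
  also note int
  finally have "integral {c..c+1} F \<le> (999/1000)^Suc n * sqrt D"
    using N e by (subst (asm) mult_le_cancel_left_pos) auto
  then show ?case unfolding F_def[abs_def] .
qed

text \<open>The geometric decay makes the square roots of the distances summable almost everywhere on each unit
  interval of the base, and countably many unit intervals cover the line.\<close>

lemma synchronization_AE:
  "AE y in lborel. (\<lambda>n. cdist (\<Phi> n y x) (\<Phi> n y x')) \<longlonglongrightarrow> 0"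
proof -
  define f where "f n y = sqrt (cdist (\<Phi> n y x) (\<Phi> n y x'))" for n y
  have f0: "0 \<le> f n y" for n y by (simp add: f_def)
  have f_cont: "continuous_on S (f n)" for n S
    unfolding f_def
    by (intro continuous_on_real_sqrt continuous_on_dist continuous_on_compose2[OF continuous_on_to_circle[of UNIV]]
        fiber_cont continuous_on_id continuous_on_const) auto
  have unit: "AE y in lborel. y \<in> {c..c+1} \<longrightarrow> (\<lambda>n. cdist (\<Phi> n y x) (\<Phi> n y x')) \<longlonglongrightarrow> 0" for c
  proof -
    have int: "(\<integral>\<^sup>+ y. ennreal (f n y) * indicator {c..c+1} y \<partial>lborel) \<le> ennreal ((999/1000)^n)" for n
    proof -
      have "almost_horizontal c (\<lambda>_. x)" for x by (simp add: almost_horizontal_def)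
      then have "integral {c..c+1} (f n) \<le> (999/1000)^n * sqrt (cdist x x')"
        unfolding f_def by (intro average_contraction) auto
      also have "\<dots> \<le> (999/1000)^n * 1"
        using of_int_round_abs_le[of "x - x'"] by (intro mult_left_mono) (auto simp: dist_to_circle abs_minus_commute)
      finally have "integral {c..c+1} (f n) \<le> (999/1000)^n" by simp
      moreover have "(f n has_integral integral {c..c+1} (f n)) {c..c+1}"
        using f_cont by (intro integrable_integral integrable_continuous_real)
      ultimately show ?thesis
        using f0 by (subst nn_integral_has_integral_lebesgue') (auto intro: ennreal_leI)
    qed
    have [measurable]: "f n \<in> borel_measurable lborel" for n
      using f_cont by (simp add: borel_measurable_continuous_onI)
    have "(\<integral>\<^sup>+ y. (\<Sum>n. ennreal (f n y) * indicator {c..c+1} y) \<partial>lborel)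
        = (\<Sum>n. \<integral>\<^sup>+ y. ennreal (f n y) * indicator {c..c+1} y \<partial>lborel)"
      by (rule nn_integral_suminf) measurable
    also have "\<dots> \<le> (\<Sum>n. ennreal ((999/1000)^n))" by (intro suminf_le int) auto
    also have "\<dots> < top" by (simp add: ennreal_suminf_neq_top summable_geometric top.not_eq_extremum[symmetric])
    finally have "AE y in lborel. (\<Sum>n. ennreal (f n y) * indicator {c..c+1} y) \<noteq> \<infinity>"
      by (intro nn_integral_PInf_AE) auto
    then show ?thesis
    proof eventually_elim
      case (elim y)
      show ?case
      proof
        assume "y \<in> {c..c+1}"
        with elim f0 have "summable (\<lambda>n. f n y)" by (intro summable_suminf_not_top) auto
        then have "(\<lambda>n. (f n y)^2) \<longlonglongrightarrow> 0^2" by (intro tendsto_power summable_LIMSEQ_zero)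
        then show "(\<lambda>n. cdist (\<Phi> n y x) (\<Phi> n y x')) \<longlonglongrightarrow> 0" by (simp add: f_def)
      qed
    qed
  qed
  have "AE y in lborel. \<forall>i::int. y \<in> {of_int i..of_int i+1} \<longrightarrow> (\<lambda>n. cdist (\<Phi> n y x) (\<Phi> n y x')) \<longlonglongrightarrow> 0"
    unfolding AE_all_countable using unit by blast
  then show ?thesis
  proof eventually_elim
    case (elim y)
    have "y \<in> {of_int \<lfloor>y\<rfloor>..of_int \<lfloor>y\<rfloor>+1}" by (auto simp: less_imp_le floor_correct)
    with elim show ?case by blast
  qed
qed

end

section \<open>Backward growth of vertical segments\<close>

lemma cos_near_odd_multiple_pi:
  assumes "\<bar>t - (2 * of_int k + 1)\<bar> \<le> 1/3"
  shows "cos (pi * t) \<le> -1/2"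
proof -
  define h where "h = t - (2 * of_int k + 1)"
  have "cos (pi/3) \<le> cos (pi * \<bar>h\<bar>)"
    using assms by (intro cos_monotone_0_pi_le) (auto simp: h_def)
  moreover have "cos (pi * \<bar>h\<bar>) = cos (pi * h)" by (cases "0 \<le> h") auto
  moreover have "cos (pi * t) = - cos (pi * h)"
  proof -
    have "pi * t = (pi * h + pi) + 2 * pi * of_int k" by (simp add: h_def algebra_simps)
    then have "cos (pi * t) = cos (pi * h + pi)"
      using cos_int_2pin[of k] sin_int_2pin[of k] by (simp only: cos_add) simp
    then show ?thesis by simp
  qed
  ultimately show ?thesis by (simp add: cos_60)
qed

context forced_lift begin

lemma fiber_expand: "x1 \<le> x2 \<Longrightarrow> (1/4)^n * (x2 - x1) \<le> \<Phi> n y x2 - \<Phi> n y x1"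
proof (induction n arbitrary: y x1 x2)
  case (Suc n)
  have B: "(x2 - x1) / 4 \<le> B y x2 - B y x1" using Suc.prems by (rule B_expand)
  have "(1/4)^Suc n * (x2 - x1) = (1/4)^n * ((x2 - x1) / 4)" by simp
  also have "\<dots> \<le> (1/4)^n * (B y x2 - B y x1)" using B by (intro mult_left_mono) auto
  also have "\<dots> \<le> \<Phi> n (b y) (B y x2) - \<Phi> n (b y) (B y x1)" using B Suc.prems by (intro Suc.IH) simp
  finally show ?case by simp
qed simp

lemma B_surj: "\<exists>x. B y x = p"
proof -
  define m where "m = 4 * \<bar>p - B y 0\<bar>"
  have "B y (- m) \<le> p" "p \<le> B y m"
    using B_expand[of 0 m y] B_expand[of "-m" 0 y] by (auto simp: m_def)
  moreover have "continuous_on {- m..m} (B y)"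
    using B_lip_x by (intro lipschitz_on_continuous_on[of 2] lipschitz_onI) (auto simp: dist_real_def)
  ultimately have "\<exists>x. - m \<le> x \<and> x \<le> m \<and> B y x = p"
    by (intro IVT') (auto simp: m_def)
  then show ?thesis by blast
qed

lemma fiber_surj: "\<exists>x. \<Phi> n y x = p"
proof (induction n arbitrary: y)
  case (Suc n)
  then show ?case using B_surj by (metis fiber.simps(2))
qed simp

lemma fiber_less_iff: "\<Phi> n y x < \<Phi> n y x' \<longleftrightarrow> x < x'"
  using fiber_strict_mono[of x x' n y] fiber_strict_mono[of x' x n y] by (cases x x' rule: linorder_cases) auto

lemma fiber_le_iff: "\<Phi> n y x \<le> \<Phi> n y x' \<longleftrightarrow> x \<le> x'"
  using fiber_less_iff[of n y x' x] by auto

lemma B_less_iff: "B y x < B y x' \<longleftrightarrow> x < x'"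
  using fiber_less_iff[of 1 y x x'] by simp

lemma base_surj: "\<exists>y. (b ^^ n) y = z"
proof (induction n)
  case (Suc n)
  then obtain y where "(b ^^ n) y = z" by blast
  moreover obtain y' where "b y' = y" by (rule b_surj)
  ultimately show ?case by (auto simp: funpow_swap1 intro!: exI[of _ y'])
qed simp

lemma base_expand_abs: "(real N - 1)^n * \<bar>y - y'\<bar> \<le> \<bar>(b ^^ n) y - (b ^^ n) y'\<bar>"
proof (induction n)
  case (Suc n)
  have "(real N - 1)^Suc n * \<bar>y - y'\<bar> = (real N - 1) * ((real N - 1)^n * \<bar>y - y'\<bar>)" by simp
  also have "\<dots> \<le> (real N - 1) * \<bar>(b ^^ n) y - (b ^^ n) y'\<bar>" using Suc N by (intro mult_left_mono) auto
  also have "\<dots> \<le> \<bar>(b ^^ Suc n) y - (b ^^ Suc n) y'\<bar>" using b_expand_abs by simp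
  finally show ?case .
qed simp

lemma base_int: "\<exists>k::int. (b ^^ n) (y + of_int m) = (b ^^ n) y + of_int k"
proof (induction n)
  case (Suc n)
  then obtain k :: int where "(b ^^ n) (y + of_int m) = (b ^^ n) y + of_int k" by blast
  then have "(b ^^ Suc n) (y + of_int m) = (b ^^ Suc n) y + of_int (k * int N)" using b_int[of _ k] by simp
  then show ?case by blast
qed auto

text \<open>Let \<open>p'\<close>, \<open>q'\<close> be the preimages of \<open>p\<close>, \<open>q\<close> in the fibre over \<open>y\<close>. The arc \<open>[p', q']\<close> is
  shortened the most by the fibre map, so its image \<open>[p, q]\<close> is the shortest, when its centre has
  phase \<open>1/2\<close>, that is when \<open>\<theta> y = p' + q' + 2 y\<close> is an odd integer. Since \<open>\<theta>\<close> is continuous and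
  increases by \<open>2\<close> over one turn of the base, it takes an odd value, and a preimage of \<open>z\<close> lies within
  \<open>1/(N - 1)\<close> of that place. Short and long arcs are treated together: the
  error relative to the model is bounded along the arc and along its complement.\<close>

lemma preimage_growth:
  assumes "p < q" "q < p + 1"
  obtains y p' q' and j :: int where "b y = z + of_int j" "B y p' = p" "B y q' = q"
    "p' < q'" "q' < p' + 1" "q - p \<le> (q' - p') - min (q' - p') (1 - (q' - p')) / 10"
proof -
  \<comment> \<open>Choosing by the same predicate over \<open>y\<close> and \<open>y + 1\<close> makes the preimage periodic in \<open>y\<close>.\<close>
  define R where "R p y = (SOME x. B y x = p)" for p y
  have R: "B y (R p y) = p" for p y unfolding R_def using B_surj by (rule someI_ex)
  have R_per: "R p (y + 1) = R p y" for p y unfolding R_def B_per_y ..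
  have R_lip: "\<bar>R p y - R p y'\<bar> \<le> 3 * \<bar>y - y'\<bar>" for p y y'
  proof -
    have "\<bar>R p y - R p y'\<bar> / 4 \<le> \<bar>B y (R p y) - B y (R p y')\<bar>"
      using B_expand[of "R p y" "R p y'" y] B_expand[of "R p y'" "R p y" y] by (cases "R p y \<le> R p y'") auto
    also have "\<dots> = \<bar>B y' (R p y') - B y (R p y')\<bar>" by (simp add: R)
    also have "\<dots> \<le> 3/4 * \<bar>y' - y\<bar>" by (rule B_lip_y)
    finally show ?thesis by (simp add: abs_minus_commute)
  qed
  define \<theta> where "\<theta> y = R p y + R q y + 2 * y" for y
  have \<theta>_lip: "\<bar>\<theta> y - \<theta> y'\<bar> \<le> 8 * \<bar>y - y'\<bar>" for y y'
  proof -
    have "\<bar>a + c + 2 * h\<bar> \<le> 8 * t" if "\<bar>a\<bar> \<le> 3 * t" "\<bar>c\<bar> \<le> 3 * t" "\<bar>h\<bar> \<le> t" for a c h t :: real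
      using that by linarith
    from this[OF R_lip R_lip order.refl] show ?thesis by (simp add: \<theta>_def algebra_simps)
  qed
  have \<theta>1: "\<theta> 1 = \<theta> 0 + 2" using R_per[of p 0] R_per[of q 0] by (simp add: \<theta>_def)
  define k where "k = \<lceil>(\<theta> 0 - 1) / 2\<rceil>"
  have "(\<theta> 0 - 1) / 2 \<le> of_int k" "of_int k \<le> (\<theta> 0 - 1) / 2 + 1"
    unfolding k_def by (rule le_of_int_ceiling, rule of_int_ceiling_le_add_one)
  then have k: "\<theta> 0 \<le> 2 * of_int k + 1" "2 * of_int k + 1 \<le> \<theta> 1"
    unfolding \<theta>1 by (simp_all add: field_simps)
  have "continuous_on {0..1} \<theta>"
    using \<theta>_lip by (intro lipschitz_on_continuous_on[of 8] lipschitz_onI) (auto simp: dist_real_def)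
  with k obtain y0 where y0: "\<theta> y0 = 2 * of_int k + 1" using IVT'[of \<theta> 0 "2 * of_int k + 1" 1] by auto
  define j where "j = round (b y0 - z)"
  obtain y where y: "b y = z + of_int j" by (rule b_surj)
  have "\<bar>b y - b y0\<bar> \<le> 1"
    using of_int_round_abs_le[of "b y0 - z"] unfolding y j_def[symmetric] by linarith
  with b_expand_abs[of y y0] have "(real N - 1) * \<bar>y - y0\<bar> \<le> 1" by (rule order.trans)
  moreover have "24 * \<bar>y - y0\<bar> \<le> (real N - 1) * \<bar>y - y0\<bar>" using N by (intro mult_right_mono) auto
  ultimately have "\<bar>\<theta> y - (2 * of_int k + 1)\<bar> \<le> 1/3" using \<theta>_lip[of y y0] y0 by simp
  then have cos: "cos (pi * \<theta> y) \<le> -1/2" by (rule cos_near_odd_multiple_pi)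
  define p' q' where "p' = R p y" and "q' = R q y"
  have pq: "B y p' = p" "B y q' = q" by (simp_all add: p'_def q'_def R)
  have lt: "p' < q'" "q' < p' + 1"
    using B_less_iff[of y p' q'] B_less_iff[of y q' "p' + 1"] assms by (simp_all add: pq B_per_x)
  define l where "l = q' - p'"
  define w where "w = wobble (q' + y) - wobble (p' + y)"
  have l: "0 < l" "l < 1" using lt by (simp_all add: l_def)
  have "w = sin (pi * l) * cos (2 * pi * (p' + y) + pi * l) / (2 * pi)"
    using wobble_diff[of "p' + y" l] by (simp add: w_def l_def algebra_simps)
  also have "2 * pi * (p' + y) + pi * l = pi * \<theta> y"
    by (simp add: \<theta>_def l_def p'_def q'_def algebra_simps)
  also have "sin (pi * l) * cos (pi * \<theta> y) / (2 * pi) \<le> (pi * min l (1 - l) / 2) * (-1/2) / (2 * pi)"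
  proof (intro divide_right_mono)
    have "sin (pi * l) * cos (pi * \<theta> y) \<le> sin (pi * l) * (-1/2)"
      using cos l by (intro mult_left_mono sin_ge_zero) auto
    also have "\<dots> \<le> (pi * min l (1 - l) / 2) * (-1/2)"
      using half_le_sin_min[of l] l by simp
    finally show "sin (pi * l) * cos (pi * \<theta> y) \<le> (pi * min l (1 - l) / 2) * (-1/2)" .
  qed simp
  also have "\<dots> = - min l (1 - l) / 8" by simp
  finally have w: "w \<le> - min l (1 - l) / 8" .
  have "q - p - l - w \<le> e * l"
    using B_close_x[of y q' p'] l by (simp add: pq w_def l_def algebra_simps abs_le_iff)
  moreover have Bp1: "B y (1 + p') = 1 + p" using B_per_x[of y p'] pq by (simp add: add.commute)
  have "q - p - l - w \<le> e * (1 - l)"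
    using B_close_x[of y "p' + 1" q'] l wobble_periodic[of "p' + y"]
    by (simp add: pq w_def l_def algebra_simps abs_le_iff Bp1)
  ultimately have "q - p - l - w \<le> e * min l (1 - l)" by (simp add: min_def)
  also have "\<dots> \<le> 1/1000000 * min l (1 - l)" using e l by (intro mult_right_mono) auto
  finally have qp: "q - p - l - w \<le> 1/1000000 * min l (1 - l)" .
  have "a \<le> l - m / 10" if "a - l - w \<le> 1/1000000 * m" "w \<le> - m / 8" "0 \<le> m" for a m
    using that by (simp add: field_simps)
  from this[OF qp w] have "q - p \<le> l - min l (1 - l) / 10" using l by simp
  then show ?thesis using that[OF y pq lt] by (simp add: l_def)
qed

text \<open>Iterating \<open>preimage_growth\<close>. The lengths increase to some \<open>l\<close> with \<open>0 < l \<le> 1\<close>; passing to the limit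
  in the growth inequality gives \<open>min l (1 - l) \<le> 0\<close>, hence \<open>l = 1\<close>.\<close>

lemma backward_orbit:
  assumes "p < q" "q < p + 1"
  shows "\<exists>Z P Q :: nat \<Rightarrow> real. (\<forall>n. (\<exists>j::int. (b ^^ n) (Z n) = z + of_int j) \<and>
    \<Phi> n (Z n) (P n) = p \<and> \<Phi> n (Z n) (Q n) = q \<and> P n < Q n \<and> Q n < P n + 1) \<and>
    (\<lambda>n. Q n - P n) \<longlonglongrightarrow> 1"
proof -
  define seg :: "real \<times> real \<times> real \<Rightarrow> bool" where "seg = (\<lambda>(z, p, q). p < q \<and> q < p + 1)"
  define rel :: "real \<times> real \<times> real \<Rightarrow> real \<times> real \<times> real \<Rightarrow> bool" where
    "rel = (\<lambda>(z, p, q) (y, p', q'). (\<exists>j::int. b y = z + of_int j) \<and> B y p' = p \<and> B y q' = q \<and>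
      q - p \<le> (q' - p') - min (q' - p') (1 - (q' - p')) / 10)"
  have "\<exists>s. \<forall>n. (seg (s n) \<and> (n = 0 \<longrightarrow> s n = (z, p, q))) \<and> rel (s n) (s (Suc n))"
  proof (rule dependent_nat_choice)
    show "\<exists>t. seg t \<and> (0 = (0::nat) \<longrightarrow> t = (z, p, q))" using assms by (simp add: seg_def)
  next
    fix t :: "real \<times> real \<times> real" and n :: nat
    assume "seg t \<and> (n = 0 \<longrightarrow> t = (z, p, q))"
    then obtain z0 p0 q0 where t: "t = (z0, p0, q0)" "p0 < q0" "q0 < p0 + 1" by (cases t) (auto simp: seg_def)
    obtain y p' q' and j :: int where "b y = z0 + of_int j" "B y p' = p0" "B y q' = q0"
      "p' < q'" "q' < p' + 1" "q0 - p0 \<le> (q' - p') - min (q' - p') (1 - (q' - p')) / 10"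
      by (rule preimage_growth[OF t(2,3), where z = z0])
    then show "\<exists>t'. (seg t' \<and> (Suc n = 0 \<longrightarrow> t' = (z, p, q))) \<and> rel t t'"
      by (intro exI[of _ "(y, p', q')"]) (auto simp: t seg_def rel_def)
  qed
  then obtain s where s: "\<And>n. seg (s n)" "s 0 = (z, p, q)" "\<And>n. rel (s n) (s (Suc n))" by blast
  define Z P Q where "Z n = fst (s n)" and "P n = fst (snd (s n))" and "Q n = snd (snd (s n))" for n
  have s0: "Z 0 = z" "P 0 = p" "Q 0 = q" by (simp_all add: Z_def P_def Q_def s)
  have lt: "P n < Q n" "Q n < P n + 1" for n
    using s(1)[of n] by (simp_all add: seg_def P_def Q_def case_prod_beta)
  have step: "\<exists>j::int. b (Z (Suc n)) = Z n + of_int j" "B (Z (Suc n)) (P (Suc n)) = P n"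
      "B (Z (Suc n)) (Q (Suc n)) = Q n"
    and grow: "Q n - P n \<le> (Q (Suc n) - P (Suc n)) - min (Q (Suc n) - P (Suc n)) (1 - (Q (Suc n) - P (Suc n))) / 10" for n
    using s(3)[of n] by (simp_all add: rel_def Z_def P_def Q_def case_prod_beta)
  have Z: "\<exists>j::int. (b ^^ n) (Z n) = z + of_int j" for n
  proof (induction n)
    case 0
    show ?case by (rule exI[of _ 0]) (simp add: s0)
  next
    case (Suc n)
    then obtain i :: int where i: "(b ^^ n) (Z n) = z + of_int i" by blast
    obtain j :: int where j: "b (Z (Suc n)) = Z n + of_int j" using step by blast
    obtain k :: int where "(b ^^ n) (Z n + of_int j) = (b ^^ n) (Z n) + of_int k" using base_int by blast
    then have "(b ^^ Suc n) (Z (Suc n)) = z + of_int (i + k)" by (simp add: funpow_swap1 j i)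
    then show ?case by blast
  qed
  have Phi: "\<Phi> n (Z n) (P n) = p \<and> \<Phi> n (Z n) (Q n) = q" for n
  proof (induction n)
    case (Suc n)
    obtain j :: int where "b (Z (Suc n)) = Z n + of_int j" using step by blast
    then show ?case using Suc by (simp add: step fiber_int_y)
  qed (simp add: s0)
  define L where "L n = Q n - P n" for n
  have L: "0 < L n" "L n < 1" "L n \<le> L (Suc n) - min (L (Suc n)) (1 - L (Suc n)) / 10" for n
    using lt[of n] grow[of n] by (simp_all add: L_def)
  have "L n \<le> L (Suc n)" for n using L(1,2)[of "Suc n"] L(3)[of n] by (simp add: min_def field_simps split: if_splits)
  then have inc: "incseq L" by (rule incseq_SucI)
  then obtain l where l: "L \<longlonglongrightarrow> l" and Ll: "\<And>n. L n \<le> l"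
    using incseq_convergent[of L 1] L(2) by (metis less_imp_le)
  have "l \<le> 1" using L(2) by (intro LIMSEQ_le_const2[OF l]) (auto intro: less_imp_le)
  have "(\<lambda>n. L (Suc n) - min (L (Suc n)) (1 - L (Suc n)) / 10) \<longlonglongrightarrow> l - min l (1 - l) / 10"
    by (intro tendsto_intros LIMSEQ_Suc l) simp
  then have "l \<le> l - min l (1 - l) / 10" using L(3) by (intro LIMSEQ_le[OF l]) auto
  moreover have "0 < l" using L(1)[of 0] Ll[of 0] by linarith
  ultimately have "l = 1" using \<open>l \<le> 1\<close> by (simp add: min_def split: if_splits)
  with l have "(\<lambda>n. Q n - P n) \<longlonglongrightarrow> 1" by (simp add: L_def[abs_def])
  with Z Phi lt show ?thesis by blast
qed

text \<open>The last \<open>M\<close> preimages only steer the base coordinate into the \<open>r\<close>-neighbourhood of \<open>u\<close>. They enlarge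
  the gap of the segment by at most \<open>4\<^sup>M\<close>, so the segment has to be grown beforehand until its gap is
  below \<open>r/4\<^sup>M\<close>. Every larger number of growth steps also works, which gives all large \<open>n\<close>.\<close>

lemma mixing_lift:
  assumes "p < q" "q < p + 1" "0 < r"
  shows "\<exists>n0. \<forall>n\<ge>n0. \<exists>y x. \<bar>y - u\<bar> < r \<and> \<bar>x - v\<bar> < r \<and> (\<exists>j::int. (b ^^ n) y = z + of_int j) \<and>
    (\<exists>m::int. p \<le> \<Phi> n y x + of_int m \<and> \<Phi> n y x + of_int m \<le> q)"
proof -
  obtain Z P Q :: "nat \<Rightarrow> real" where Z: "\<And>n. \<exists>j::int. (b ^^ n) (Z n) = z + of_int j"
    and PQ: "\<And>n. \<Phi> n (Z n) (P n) = p" "\<And>n. \<Phi> n (Z n) (Q n) = q"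
    and lt: "\<And>n. P n < Q n" "\<And>n. Q n < P n + 1" and lim: "(\<lambda>n. Q n - P n) \<longlonglongrightarrow> 1"
    using backward_orbit[OF assms(1,2), of z] by blast
  obtain M where M: "(1/999999)^M < r" using real_arch_pow_inv[of r "1/999999"] assms by auto
  have "0 < r / 4^M" using assms by simp
  with lim have "\<forall>\<^sub>F i in sequentially. dist (Q i - P i) 1 < r / 4^M" by (rule tendstoD)
  then obtain K where K: "\<And>i. K \<le> i \<Longrightarrow> dist (Q i - P i) 1 < r / 4^M"
    by (auto simp: eventually_sequentially)
  have "\<exists>y x. \<bar>y - u\<bar> < r \<and> \<bar>x - v\<bar> < r \<and> (\<exists>j::int. (b ^^ n) y = z + of_int j) \<and>
    (\<exists>m::int. p \<le> \<Phi> n y x + of_int m \<and> \<Phi> n y x + of_int m \<le> q)" if "M + K \<le> n" for n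
  proof -
    define i where "i = n - M"
    have n: "n = M + i" and Ki: "K \<le> i" using that by (simp_all add: i_def)
    define j where "j = round ((b ^^ M) u - Z i)"
    obtain y where y: "(b ^^ M) y = Z i + of_int j" using base_surj by blast
    have "\<bar>y - u\<bar> < r"
    proof -
      have "999999^M * \<bar>y - u\<bar> \<le> (real N - 1)^M * \<bar>y - u\<bar>"
        using N by (intro mult_right_mono power_mono) auto
      also have "\<dots> \<le> \<bar>(b ^^ M) y - (b ^^ M) u\<bar>" by (rule base_expand_abs)
      also have "\<dots> \<le> 1"
        using of_int_round_abs_le[of "(b ^^ M) u - Z i"] unfolding y j_def[symmetric] by linarith
      finally have "\<bar>y - u\<bar> \<le> (1/999999)^M" by (simp add: field_simps power_divide)
      with M show ?thesis by simp
    qed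
    moreover have "\<exists>k::int. (b ^^ n) y = z + of_int k"
    proof -
      have "(b ^^ n) y = (b ^^ i) (Z i + of_int j)" unfolding n add.commute[of M i] funpow_add by (simp add: y)
      then show ?thesis using base_int[of i "Z i" j] Z[of i] by (metis add.assoc of_int_add)
    qed
    moreover have "\<exists>x. \<bar>x - v\<bar> < r \<and> (\<exists>m::int. p \<le> \<Phi> n y x + of_int m \<and> \<Phi> n y x + of_int m \<le> q)"
    proof -
      obtain p' q' where p': "\<Phi> M y p' = P i" and q': "\<Phi> M y q' = Q i" using fiber_surj by metis
      have p1: "\<Phi> M y (p' + 1) = P i + 1" using fiber_int_x[of M y p' 1] p' by simp
      have le: "p' < q'" "q' < p' + 1"
        using fiber_less_iff[of M y p' q'] fiber_less_iff[of M y q' "p' + 1"] lt[of i] by (simp_all add: p' q' p1)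
      have "(1/4)^M * (p' + 1 - q') \<le> P i + 1 - Q i"
        using fiber_expand[of q' "p' + 1" M y] le by (simp add: p1 q')
      also have "\<dots> < r / 4^M" using K[OF Ki] lt[of i] by (simp add: dist_real_def)
      finally have gap: "p' + 1 - q' < r" by (simp add: power_divide divide_less_cancel)
      define k where "k = \<lfloor>v - p'\<rfloor>"
      have k: "p' \<le> v - of_int k" "v - of_int k < p' + 1" unfolding k_def by linarith+
      have "\<exists>x m. \<bar>x - v\<bar> < r \<and> p' \<le> x + of_int m \<and> x + of_int m \<le> q'"
      proof (cases "v - of_int k \<le> q'")
        case True
        with k assms show ?thesis by (intro exI[of _ v] exI[of _ "- k"]) auto
      next
        \<comment> \<open>The representative of \<open>v\<close> fell into the gap, whose right end is the next copy of \<open>p'\<close>.\<close>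
        case False
        with k gap le show ?thesis by (intro exI[of _ "p' + 1 + of_int k"] exI[of _ "- k - 1"]) auto
      qed
      then obtain x m where x: "\<bar>x - v\<bar> < r" "p' \<le> x + of_int m" "x + of_int m \<le> q'" by blast
      have "\<Phi> n y x + of_int m = \<Phi> i (Z i) (\<Phi> M y (x + of_int m))"
        by (simp add: n fiber_add y fiber_int_y fiber_int_x)
      moreover have "P i \<le> \<Phi> M y (x + of_int m)" "\<Phi> M y (x + of_int m) \<le> Q i"
        using x by (simp_all only: p'[symmetric] q'[symmetric] fiber_le_iff)
      ultimately have "p \<le> \<Phi> n y x + of_int m" "\<Phi> n y x + of_int m \<le> q"
        by (simp_all only: PQ[of i, symmetric] fiber_le_iff)
      with x show ?thesis by blast
    qed
    ultimately show ?thesis by blast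
  qed
  then show ?thesis by blast
qed

end

section \<open>Torus maps and their lifts\<close>

lemma to_circle_surj: "\<exists>x. to_circle x = t"
  by (metis Quotient_circle Quotient_abs_rep)

lemma to_torus_simp [simp]: "to_torus (y, x) = (to_circle y, to_circle x)"
  by (simp add: to_torus_def)

lemma to_torus_surj: "\<exists>z. to_torus z = p"
proof -
  obtain y x where "to_circle y = fst p" "to_circle x = snd p" using to_circle_surj by metis
  then show ?thesis by (intro exI[of _ "(y, x)"]) simp
qed

lemma nearest_lift: "\<exists>y. to_circle y = t \<and> dist y x = dist t (to_circle x)"
proof -
  obtain s where s: "to_circle s = t" using to_circle_surj by blast
  let ?y = "s - of_int (round (s - x))"
  have "to_circle ?y = t" using s by simp
  moreover have "dist ?y x = dist t (to_circle x)" unfolding s[symmetric] dist_to_circle dist_real_def by simp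
  ultimately show ?thesis by blast
qed

lemma nearest_torus_lift: "\<exists>w. to_torus w = p \<and> dist w z = dist p (to_torus z)"
proof -
  obtain y where y: "to_circle y = fst p" "dist y (fst z) = dist (fst p) (to_circle (fst z))" using nearest_lift by blast
  obtain x where x: "to_circle x = snd p" "dist x (snd z) = dist (snd p) (to_circle (snd z))" using nearest_lift by blast
  show ?thesis using x y by (intro exI[of _ "(y, x)"]) (simp add: dist_prod_def to_torus_def)
qed

lemma dist_to_torus_le: "dist (to_torus w) (to_torus z) \<le> dist w z"
  by (auto simp: dist_prod_def to_torus_def intro!: real_sqrt_le_mono add_mono power_mono dist_to_circle_le)

lemma smooth_differentiable: "smooth A \<Longrightarrow> A differentiable (at z)"
  unfolding smooth_def by (metis empty_set empty_subsetI iter_deriv.simps(1))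

lemma smooth_continuous: "smooth A \<Longrightarrow> continuous_on S A"
  by (meson continuous_at_imp_continuous_on differentiable_imp_continuous_within smooth_differentiable)

lemma torus_lift_continuous:
  assumes "torus_lift A F" shows "continuous_on UNIV F"
  unfolding continuous_on_iff
proof (intro ballI allI impI)
  fix p :: torus and r :: real assume "0 < r"
  obtain z where z: "to_torus z = p" using to_torus_surj by blast
  have A: "continuous_on UNIV A" and AF: "\<And>z. to_torus (A z) = F (to_torus z)"
    using assms by (auto simp: torus_lift_def intro: smooth_continuous)
  from A \<open>0 < r\<close> obtain d where d: "0 < d" "\<And>w. dist w z < d \<Longrightarrow> dist (A w) (A z) < r"
    unfolding continuous_on_iff by blast
  have "dist (F q) (F p) < r" if q: "dist q p < d" for q
  proof -
    obtain w where w: "to_torus w = q" "dist w z = dist q p" using nearest_torus_lift z by blast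
    have "dist (F q) (F p) \<le> dist (A w) (A z)"
      using dist_to_torus_le[of "A w" "A z"] by (simp add: AF w z)
    also have "\<dots> < r" using d w q by simp
    finally show ?thesis .
  qed
  with d show "\<exists>d>0. \<forall>q\<in>UNIV. dist q p < d \<longrightarrow> dist (F q) (F p) < r" by blast
qed

lemma continuous_Ints_valued_constant:
  fixes f :: "'a::real_normed_vector \<Rightarrow> real"
  assumes "continuous_on UNIV f" "\<And>z. f z \<in> \<int>"
  shows "f z = f w"
proof -
  have "f constant_on UNIV"
  proof (rule continuous_discrete_range_constant[OF connected_UNIV assms(1)])
    fix x
    have "1 \<le> norm (f y - f x)" if "f y \<noteq> f x" for y
      using that Ints_nonzero_abs_ge1[of "f y - f x"] assms(2) by auto
    then show "\<exists>e>0. \<forall>y. y \<in> UNIV \<and> f y \<noteq> f x \<longrightarrow> e \<le> norm (f y - f x)" by (intro exI[of _ 1]) auto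
  qed
  then show ?thesis by (auto simp: constant_on_def)
qed

text \<open>The difference of two lifts is continuous and has integer coordinates.\<close>

lemma torus_lift_unique:
  assumes "torus_lift A F" "torus_lift B F"
  shows "A z - B z = A w - B w"
proof -
  have c: "continuous_on UNIV A" "continuous_on UNIV B" using assms by (auto simp: torus_lift_def intro: smooth_continuous)
  have "to_torus (A z) = to_torus (B z)" for z using assms by (simp add: torus_lift_def del: split_paired_All)
  then have i: "fst (A z - B z) \<in> \<int>" "snd (A z - B z) \<in> \<int>" for z
    by (simp_all add: to_torus_def map_prod_def case_prod_beta to_circle_eq_iff)
  have "fst (A z - B z) = fst (A w - B w)"
    by (rule continuous_Ints_valued_constant[where f = "\<lambda>z. fst (A z - B z)"]) (use i c in \<open>auto intro!: continuous_intros\<close>)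
  moreover have "snd (A z - B z) = snd (A w - B w)"
    by (rule continuous_Ints_valued_constant[where f = "\<lambda>z. snd (A z - B z)"]) (use i c in \<open>auto intro!: continuous_intros\<close>)
  ultimately show ?thesis by (rule prod_eqI)
qed

lemma torus_lift_derivative_unique:
  assumes "torus_lift A F" "torus_lift B F"
  shows "iter_deriv [v] A z = iter_deriv [v] B z"
proof -
  have "(B has_derivative frechet_derivative B (at z)) (at z)"
    using assms smooth_differentiable by (auto simp: torus_lift_def frechet_derivative_works)
  then have "((\<lambda>w. B w + (A z - B z)) has_derivative (\<lambda>h. frechet_derivative B (at z) h + 0)) (at z)"
    by (intro derivative_intros)
  moreover have "(\<lambda>w. B w + (A z - B z)) = A"
  proof
    fix w show "B w + (A z - B z) = A w" unfolding torus_lift_unique[OF assms, of z w] by simp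
  qed
  ultimately have "(A has_derivative frechet_derivative B (at z)) (at z)" by simp
  then show ?thesis by (simp add: frechet_derivative_at[symmetric])
qed

definition model_lift :: "real \<times> real \<Rightarrow> real \<times> real"
  where "model_lift z = (1000000 * fst z, snd z + wobble (fst z + snd z))"

text \<open>The uniform bound is kept strictly below the threshold, so that it leaves room for perturbation;
  pointwise strict bounds need not define an open set.\<close>

definition near_model :: "(torus \<Rightarrow> torus) set" where
  "near_model = {F. \<exists>B \<delta>. torus_lift B F \<and> \<delta> < 1/1000000 \<and>
     (\<forall>v\<in>Basis. \<forall>z. dist (iter_deriv [v] model_lift z) (iter_deriv [v] B z) \<le> \<delta>)}"

text \<open>The lift witnessing closeness to the model and the one witnessing \<open>Ck_close\<close> may differ by a
  constant, which first derivatives do not see.\<close>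

lemma openin_near_model: assumes "1 \<le> k" shows "openin (Ck_topology k) near_model"
  unfolding openin_Ck_topology
proof (intro conjI ballI)
  show "near_model \<subseteq> Collect smooth_torus_map" by (auto simp: near_model_def smooth_torus_map_def)
  fix F assume "F \<in> near_model"
  then obtain B \<delta> where B: "torus_lift B F" "\<delta> < 1/1000000"
    "\<And>v z. v \<in> Basis \<Longrightarrow> dist (iter_deriv [v] model_lift z) (iter_deriv [v] B z) \<le> \<delta>"
    by (auto simp: near_model_def)
  define \<epsilon> where "\<epsilon> = (1/1000000 - \<delta>) / 2"
  have \<epsilon>: "0 < \<epsilon>" "\<delta> + \<epsilon> < 1/1000000" using B(2) by (simp_all add: \<epsilon>_def field_simps)
  have "G \<in> near_model" if close: "Ck_close k \<epsilon> F G" for G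
  proof -
    obtain A C where A: "torus_lift A F" "torus_lift C G"
      "\<forall>vs z. set vs \<subseteq> Basis \<and> length vs \<le> k \<longrightarrow> dist (iter_deriv vs A z) (iter_deriv vs C z) < \<epsilon>"
      using close unfolding Ck_close_def by blast
    have "dist (iter_deriv [v] model_lift z) (iter_deriv [v] C z) \<le> \<delta> + \<epsilon>" if "v \<in> Basis" for v z
    proof -
      have "dist (iter_deriv [v] A z) (iter_deriv [v] C z) < \<epsilon>" using A(3)[rule_format, of "[v]" z] that assms by simp
      then have "dist (iter_deriv [v] B z) (iter_deriv [v] C z) < \<epsilon>"
        unfolding torus_lift_derivative_unique[OF A(1) B(1)] .
      then show ?thesis using B(3)[OF that, of z] dist_triangle[of "iter_deriv [v] model_lift z" "iter_deriv [v] C z" "iter_deriv [v] B z"]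
        by linarith
    qed
    with A(2) \<epsilon>(2) show ?thesis unfolding near_model_def by blast
  qed
  with \<epsilon>(1) show "\<exists>\<epsilon>>0. \<forall>G. Ck_close k \<epsilon> F G \<longrightarrow> G \<in> near_model" by blast
qed

lemma partial_derivatives:
  fixes B :: "real \<times> real \<Rightarrow> real \<times> real"
  assumes "(B has_derivative D) (at (y, x))"
  shows "((\<lambda>t. fst (B (t, x))) has_real_derivative fst (D (1, 0))) (at y)"
    "((\<lambda>t. snd (B (t, x))) has_real_derivative snd (D (1, 0))) (at y)"
    "((\<lambda>t. fst (B (y, t))) has_real_derivative fst (D (0, 1))) (at x)"
    "((\<lambda>t. snd (B (y, t))) has_real_derivative snd (D (0, 1))) (at x)"
proof -
  have D: "linear D" using assms has_derivative_linear by blast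
  have "((\<lambda>t. B (t, x)) has_derivative (\<lambda>h. D (h, 0))) (at y)"
    by (rule has_derivative_compose[of "\<lambda>t. (t, x)", OF _ assms]) (auto intro!: derivative_eq_intros)
  moreover have "(\<lambda>h. D (h, 0)) = (\<lambda>h. h *\<^sub>R D (1, 0))"
  proof
    fix h show "D (h, 0) = h *\<^sub>R D (1, 0)" using linear_scale[OF D, of h "(1, 0)"] by simp
  qed
  ultimately have 1: "((\<lambda>t. B (t, x)) has_vector_derivative D (1, 0)) (at y)"
    by (simp only: has_vector_derivative_def)
  have "((\<lambda>t. B (y, t)) has_derivative (\<lambda>h. D (0, h))) (at x)"
    by (rule has_derivative_compose[of "\<lambda>t. (y, t)", OF _ assms]) (auto intro!: derivative_eq_intros)
  moreover have "(\<lambda>h. D (0, h)) = (\<lambda>h. h *\<^sub>R D (0, 1))"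
  proof
    fix h show "D (0, h) = h *\<^sub>R D (0, 1)" using linear_scale[OF D, of h "(0, 1)"] by simp
  qed
  ultimately have 2: "((\<lambda>t. B (y, t)) has_vector_derivative D (0, 1)) (at x)"
    by (simp only: has_vector_derivative_def)
  show "((\<lambda>t. fst (B (t, x))) has_real_derivative fst (D (1, 0))) (at y)"
    "((\<lambda>t. snd (B (t, x))) has_real_derivative snd (D (1, 0))) (at y)"
    "((\<lambda>t. fst (B (y, t))) has_real_derivative fst (D (0, 1))) (at x)"
    "((\<lambda>t. snd (B (y, t))) has_real_derivative snd (D (0, 1))) (at x)"
    using bounded_linear.has_vector_derivative[OF bounded_linear_fst 1] bounded_linear.has_vector_derivative[OF bounded_linear_snd 1]
      bounded_linear.has_vector_derivative[OF bounded_linear_fst 2] bounded_linear.has_vector_derivative[OF bounded_linear_snd 2]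
    by (simp_all add: has_real_derivative_iff_has_vector_derivative)
qed

lemma wobble_deriv: "(wobble has_real_derivative cos (2 * pi * t) / 2) (at t within S)"
  unfolding wobble_def[abs_def] by (auto intro!: derivative_eq_intros simp: field_simps)

lemma model_lift_has_derivative:
  "(model_lift has_derivative (\<lambda>h. (1000000 * fst h, snd h + cos (2 * pi * (fst z + snd z)) / 2 * (fst h + snd h)))) (at z)"
proof -
  have "((\<lambda>z. wobble (fst z + snd z)) has_derivative (\<lambda>h. (fst h + snd h) * (cos (2 * pi * (fst z + snd z)) / 2))) (at z)"
    by (rule DERIV_compose_FDERIV[OF wobble_deriv]) (auto intro!: derivative_eq_intros)
  then show ?thesis unfolding model_lift_def[abs_def]
    by (auto intro!: derivative_eq_intros simp: mult.commute)
qed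

lemma lipschitz_from_derivative:
  fixes f :: "real \<Rightarrow> real"
  assumes "\<And>t. (f has_real_derivative f' t) (at t)" "\<And>t. \<bar>f' t\<bar> \<le> L"
  shows "\<bar>f t - f s\<bar> \<le> L * \<bar>t - s\<bar>"
  using field_differentiable_bound[of UNIV f f' L s t] assms
  by (simp add: abs_minus_commute)

lemma Ints_near_eq: "m - of_int k \<in> \<int> \<Longrightarrow> \<bar>m - of_int k\<bar> < 1 \<Longrightarrow> m = (of_int k :: real)"
  by (metis Ints_nonzero_abs_ge1 eq_iff_diff_eq_0 linorder_not_le)

text \<open>The periodicity relations hold up to integers for any lift. Closeness to the model determines these
  integers, since the increments over one period differ from those of the model by less than \<open>1\<close>.\<close>

lemma near_model_lift:
  assumes F: "F = skew_product g f" and near: "F \<in> near_model"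
  obtains b b' B where "forced_lift b b' B 1000000 (1/1000000)"
    "\<And>y x. F (to_torus (y, x)) = to_torus (b y, B y x)"
proof -
  obtain A \<delta> where A: "torus_lift A F" "\<delta> < 1/1000000"
    "\<And>v z. v \<in> Basis \<Longrightarrow> dist (iter_deriv [v] model_lift z) (iter_deriv [v] A z) \<le> \<delta>"
    using near by (auto simp: near_model_def)
  define D where "D z = frechet_derivative A (at z)" for z
  define e :: real where "e = 1/1000000"
  have D: "(A has_derivative D z) (at z)" for z
    using A smooth_differentiable by (auto simp: torus_lift_def frechet_derivative_works D_def)
  have AF: "to_torus (A z) = F (to_torus z)" for z using A(1) by (simp add: torus_lift_def del: split_paired_All)
  have c1: "to_circle (fst (A (y, x))) = g (to_circle y)" for y x
    using AF[of "(y, x)"] by (cases "A (y, x)") (simp add: F skew_product_def)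
  have c2: "to_circle (snd (A (y, x))) = f (to_circle y) (to_circle x)" for y x
    using AF[of "(y, x)"] by (cases "A (y, x)") (simp add: F skew_product_def)
  let ?C = "\<lambda>y x. cos (2 * pi * (y + x)) / 2"
  have Dm: "frechet_derivative model_lift (at z) h =
      (1000000 * fst h, snd h + cos (2 * pi * (fst z + snd z)) / 2 * (fst h + snd h))" for z h
    by (subst frechet_derivative_at[OF model_lift_has_derivative, symmetric]) (rule refl)
  have Basis: "(1, 0) \<in> (Basis :: (real \<times> real) set)" "(0, 1) \<in> (Basis :: (real \<times> real) set)"
    by (simp_all add: Basis_prod_def)
  have comp: "\<bar>fst p - fst q\<bar> \<le> e" "\<bar>snd p - snd q\<bar> \<le> e" if "dist p q \<le> \<delta>" for p q :: "real \<times> real"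
    using that A(2) dist_fst_le[of p q] dist_snd_le[of p q] by (simp_all add: dist_real_def e_def)
  have close: "\<bar>fst (D (y, x) (1, 0)) - 1000000\<bar> \<le> e" "\<bar>snd (D (y, x) (1, 0)) - ?C y x\<bar> \<le> e"
     "\<bar>snd (D (y, x) (0, 1)) - (1 + ?C y x)\<bar> \<le> e" for y x
    using comp[OF A(3)[OF Basis(1), of "(y, x)"]] comp[OF A(3)[OF Basis(2), of "(y, x)"]]
    by (simp_all add: Dm D_def abs_minus_commute)
  define b where "b y = fst (A (y, 0))" for y
  define b' where "b' y = fst (D (y, 0) (1, 0))" for y
  define B where "B y x = snd (A (y, x))" for y x
  note pd = partial_derivatives[OF D]
  have b_deriv: "(b has_real_derivative b' y) (at y)" for y unfolding b_def[abs_def] b'_def by (rule pd)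
  have b'_close: "\<bar>b' y - 1000000\<bar> \<le> e" for y unfolding b'_def by (rule close)
  have fst_A: "fst (A (y, x)) = b y" for y x
  proof -
    have "continuous_on UNIV (\<lambda>x. fst (A (y, x)))" 
      by (rule DERIV_continuous_on, rule has_field_derivative_at_within, rule pd)
    then have "continuous_on UNIV (\<lambda>x. fst (A (y, x)) - b y)"
      by (intro continuous_on_diff continuous_on_const)
    moreover have "fst (A (y, x)) - b y \<in> \<int>" for x
      unfolding b_def to_circle_eq_iff[symmetric] c1 ..
    ultimately have "fst (A (y, x)) - b y = fst (A (y, 0)) - b y" by (rule continuous_Ints_valued_constant)
    then show ?thesis by (simp add: b_def)
  qed
  have lift: "F (to_torus (y, x)) = to_torus (b y, B y x)" for y x
    using AF[of "(y, x)"] fst_A[of y x] by (cases "A (y, x)") (simp add: B_def)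
  have C_le: "\<bar>?C y x\<bar> \<le> 1/2" for y x by simp
  have B_lip_y: "\<bar>B y x - B y' x\<bar> \<le> 3/4 * \<bar>y - y'\<bar>" for y y' x
    unfolding B_def
  proof (rule lipschitz_from_derivative[OF pd(2)])
    fix t show "\<bar>snd (D (t, x) (1, 0))\<bar> \<le> 3/4" using close(2)[of t x] C_le[of t x] unfolding e_def by linarith
  qed
  have B_close_x: "\<bar>(B y x2 - x2 - wobble (x2 + y)) - (B y x1 - x1 - wobble (x1 + y))\<bar> \<le> e * \<bar>x2 - x1\<bar>" for y x1 x2
  proof (rule lipschitz_from_derivative[where f = "\<lambda>x. B y x - x - wobble (x + y)"])
    fix t
    have "((\<lambda>x. wobble (x + y)) has_real_derivative ?C y t * 1) (at t)"
      unfolding add.commute[of y t]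
      by (rule DERIV_chain2[where g = "\<lambda>x. x + y", OF wobble_deriv]) (auto intro!: derivative_eq_intros)
    then show "((\<lambda>x. B y x - x - wobble (x + y)) has_real_derivative snd (D (y, t) (0, 1)) - 1 - ?C y t * 1) (at t)"
      unfolding B_def by (intro derivative_intros pd)
    show "\<bar>snd (D (y, t) (0, 1)) - 1 - ?C y t * 1\<bar> \<le> e" using close(3)[of y t] by (simp add: diff_diff_eq)
  qed
  have b_per: "b (y + 1) = b y + real 1000000" for y
  proof -
    have lip: "\<bar>(b (y + 1) - 1000000 * (y + 1)) - (b y - 1000000 * y)\<bar> \<le> e * \<bar>(y + 1) - y\<bar>"
      by (rule lipschitz_from_derivative[where f = "\<lambda>y. b y - 1000000 * y" and f' = "\<lambda>y. b' y - 1000000"])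
        (use b_deriv b'_close in \<open>auto intro!: derivative_eq_intros\<close>)
    have eq: "b (y + 1) - b y - of_int 1000000 = (b (y + 1) - 1000000 * (y + 1)) - (b y - 1000000 * y)" by simp
    have 1: "\<bar>b (y + 1) - b y - of_int 1000000\<bar> < 1"
      unfolding eq by (rule le_less_trans[OF lip]) (simp add: e_def)
    have "to_circle (b (y + 1)) = to_circle (b y)"
      using c1[of "y + 1" 0] c1[of y 0] to_circle_add_int[of y 1] by (simp add: b_def)
    then have "b (y + 1) - b y - of_int 1000000 \<in> \<int>" unfolding to_circle_eq_iff by simp
    from Ints_near_eq[OF this 1] show ?thesis by simp
  qed
  have B_per_x: "B y (x + 1) = B y x + 1" for y x
  proof -
    have "wobble ((x + 1) + y) = wobble (x + y)" using wobble_periodic[of "x + y"] by (simp add: add_ac)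
    then have eq: "B y (x + 1) - B y x - of_int 1
        = (B y (x + 1) - (x + 1) - wobble ((x + 1) + y)) - (B y x - x - wobble (x + y))" by simp
    have 1: "\<bar>B y (x + 1) - B y x - of_int 1\<bar> < 1"
      unfolding eq by (rule le_less_trans[OF B_close_x]) (simp add: e_def)
    have "to_circle (B y (x + 1)) = to_circle (B y x)"
      using c2[of y "x + 1"] c2[of y x] to_circle_add_int[of x 1] by (simp add: B_def)
    then have "B y (x + 1) - B y x - of_int 1 \<in> \<int>" unfolding to_circle_eq_iff by simp
    from Ints_near_eq[OF this 1] show ?thesis by simp
  qed
  have B_per_y: "B (y + 1) x = B y x" for y x
  proof -
    have 1: "\<bar>B (y + 1) x - B y x - of_int 0\<bar> < 1" using B_lip_y[of "y + 1" x y] by simp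
    have "to_circle (B (y + 1) x) = to_circle (B y x)"
      using c2[of "y + 1" x] c2[of y x] to_circle_add_int[of y 1] by (simp add: B_def)
    then have "B (y + 1) x - B y x - of_int 0 \<in> \<int>" unfolding to_circle_eq_iff by simp
    from Ints_near_eq[OF this 1] show ?thesis by simp
  qed
  have "forced_lift b b' B 1000000 e"
  proof
    show "1000000 \<le> (1000000::nat)" "0 \<le> e" "e \<le> 1/1000000" by (simp_all add: e_def)
    show "\<bar>b' y - real 1000000\<bar> \<le> e" for y using b'_close by simp
  qed (rule b_deriv b_per B_per_x B_per_y B_close_x B_lip_y)+
  then show ?thesis using that lift unfolding e_def by blast
qed

text \<open>A smooth lift of \<open>g\<close> differs from \<open>b\<close> by a constant, so it inherits the derivative of \<open>b\<close>.\<close>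

lemma near_model_expanding:
  assumes "F = skew_product g f" "F \<in> near_model" "smooth_circle_map g"
  shows "expanding g"
proof -
  obtain b b' B where lift: "forced_lift b b' B 1000000 (1/1000000)"
    "\<And>y x. F (to_torus (y, x)) = to_torus (b y, B y x)"
    using near_model_lift[OF assms(1,2)] by blast
  interpret forced_lift b b' B 1000000 "1/1000000" by (rule lift(1))
  obtain A where A: "circle_lift A g" using assms(3) by (auto simp: smooth_circle_map_def)
  have "to_circle (A y) = to_circle (b y)" for y
    using A lift(2)[of y 0] by (simp add: circle_lift_def assms(1) skew_product_def)
  then have i: "A y - b y \<in> \<int>" for y by (simp add: to_circle_eq_iff)
  have "continuous_on UNIV (\<lambda>y. A y - b y)"
    using A b_cont by (intro continuous_intros) (auto simp: circle_lift_def intro: smooth_continuous)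
  then have "A y - b y = A 0 - b 0" for y using i by (rule continuous_Ints_valued_constant)
  then have Ab: "A = (\<lambda>y. b y + (A 0 - b 0))" by (auto simp: fun_eq_iff algebra_simps)
  have "(A has_real_derivative b' y) (at y)" for y
    by (subst Ab) (auto intro!: derivative_eq_intros b_deriv)
  then have "deriv A y = b' y" for y by (rule DERIV_imp_deriv)
  moreover have "1 < \<bar>b' y\<bar>" for y using b'_close[of y] by (simp add: abs_if split: if_splits)
  ultimately show ?thesis using A unfolding expanding_def by auto
qed

section \<open>Mixing and synchronization on the torus\<close>

locale forced_torus_map = forced_lift +
  fixes F :: "torus \<Rightarrow> torus"
  assumes F_lift: "F (to_torus (y, x)) = to_torus (b y, B y x)"
    and F_cont: "continuous_on UNIV F"
begin

lemma F_iterate: "(F ^^ n) (to_torus (y, x)) = to_torus ((b ^^ n) y, \<Phi> n y x)"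
proof (induction n arbitrary: y x)
  case (Suc n)
  have "(F ^^ Suc n) (to_torus (y, x)) = (F ^^ n) (F (to_torus (y, x)))" by (simp only: funpow_Suc_right o_apply)
  also have "\<dots> = to_torus ((b ^^ Suc n) y, \<Phi> (Suc n) y x)"
    unfolding F_lift Suc by (simp add: funpow_swap1)
  finally show ?case .
qed simp

lemma torus_mixing: "topologically_mixing F"
  unfolding topologically_mixing_def
proof (intro allI impI)
  fix U V :: "torus set" assume UV: "open U \<and> U \<noteq> {} \<and> open V \<and> V \<noteq> {}"
  have box: "\<exists>u v r. 0 < r \<and> (\<forall>y x. \<bar>y - u\<bar> < r \<and> \<bar>x - v\<bar> < r \<longrightarrow> to_torus (y, x) \<in> W)" if W: "open W" "W \<noteq> {}" for W
  proof -
    obtain z where z: "to_torus z \<in> W" using W(2) to_torus_surj by (metis ex_in_conv)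
    have op: "open (to_torus -` W)" using W(1) continuous_on_to_torus by (rule open_vimage)
    have "z \<in> to_torus -` W" using z by simp
    then obtain r where r: "0 < r" "ball z r \<subseteq> to_torus -` W" by (rule openE[OF op])
    have "to_torus (y, x) \<in> W" if "\<bar>y - fst z\<bar> < r / 2" "\<bar>x - snd z\<bar> < r / 2" for y x
    proof -
      have "dist (y, x) z \<le> \<bar>y - fst z\<bar> + \<bar>x - snd z\<bar>"
        using sqrt_sum_squares_le_sum_abs[of "y - fst z" "x - snd z"] by (simp add: dist_prod_def dist_real_def)
      then have "dist (y, x) z < r" using that by linarith
      then have "(y, x) \<in> ball z r" by (simp add: dist_commute)
      with r(2) have "(y, x) \<in> to_torus -` W" by (rule subsetD)
      then show ?thesis by simp
    qed
    with r(1) show ?thesis by (intro exI[of _ "fst z"] exI[of _ "snd z"] exI[of _ "r / 2"]) simp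
  qed
  obtain u v r where r: "0 < r" "\<forall>y x. \<bar>y - u\<bar> < r \<and> \<bar>x - v\<bar> < r \<longrightarrow> to_torus (y, x) \<in> U"
    using box[of U] UV by auto
  obtain z w s where s: "0 < s" "\<forall>y x. \<bar>y - z\<bar> < s \<and> \<bar>x - w\<bar> < s \<longrightarrow> to_torus (y, x) \<in> V"
    using box[of V] UV by auto
  define h where "h = min (s / 2) (1/4)"
  have h: "0 < h" "h < s" "h < 1/2" using s(1) by (auto simp: h_def)
  have hw: "w - h < w + h" "w + h < w - h + 1" using h by linarith+
  obtain n0 where n0: "\<forall>n\<ge>n0. \<exists>y x. \<bar>y - u\<bar> < r \<and> \<bar>x - v\<bar> < r \<and> (\<exists>j::int. (b ^^ n) y = z + of_int j) \<and>
    (\<exists>m::int. w - h \<le> \<Phi> n y x + of_int m \<and> \<Phi> n y x + of_int m \<le> w + h)"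
    using mixing_lift[of "w - h" "w + h" r u v z, OF _ _ r(1)] hw by blast
  have "(F ^^ n) ` U \<inter> V \<noteq> {}" if n: "n0 \<le> n" for n
  proof -
    obtain y x and j m :: int where 1: "\<bar>y - u\<bar> < r" "\<bar>x - v\<bar> < r" "(b ^^ n) y = z + of_int j"
      "w - h \<le> \<Phi> n y x + of_int m" "\<Phi> n y x + of_int m \<le> w + h" using n0 n by blast
    have "(F ^^ n) (to_torus (y, x)) = to_torus (z, \<Phi> n y x + of_int m)"
      by (subst F_iterate) (simp add: 1(3))
    moreover have "to_torus (z, \<Phi> n y x + of_int m) \<in> V"
    proof -
      have "\<bar>(\<Phi> n y x + of_int m) - w\<bar> < s" using 1 h by linarith
      then show ?thesis using s(1) s(2)[rule_format, of z "\<Phi> n y x + of_int m"] by simp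
    qed
    moreover have "to_torus (y, x) \<in> U" using r(2) 1(1,2) by blast
    ultimately show ?thesis by (metis disjoint_iff image_eqI)
  qed
  then show "\<forall>\<^sub>F n in sequentially. (F ^^ n) ` U \<inter> V \<noteq> {}" unfolding eventually_sequentially by blast
qed

text \<open>Comparison with a single reference point of the fibre makes membership a condition on one point,
  to which Fubini applies.\<close>

definition synchronized :: "torus set" where
  "synchronized = {p. (\<lambda>n. dist ((F ^^ n) p) ((F ^^ n) (fst p, to_circle 0))) \<longlonglongrightarrow> 0}"

lemma synchronized_pair:
  assumes "(y, x1) \<in> synchronized" "(y, x2) \<in> synchronized"
  shows "(\<lambda>n. dist ((F ^^ n) (y, x1)) ((F ^^ n) (y, x2))) \<longlonglongrightarrow> 0"
proof -
  let ?c = "\<lambda>n. (F ^^ n) (y, to_circle 0)"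
  have "(\<lambda>n. dist ((F ^^ n) (y, x1)) (?c n) + dist ((F ^^ n) (y, x2)) (?c n)) \<longlonglongrightarrow> 0 + 0"
    using assms by (intro tendsto_add) (simp_all add: synchronized_def)
  then have "(\<lambda>n. dist ((F ^^ n) (y, x1)) (?c n) + dist ((F ^^ n) (y, x2)) (?c n)) \<longlonglongrightarrow> 0" by simp
  then show ?thesis
  proof (rule Lim_null_comparison[rotated], intro always_eventually allI)
    fix n show "norm (dist ((F ^^ n) (y, x1)) ((F ^^ n) (y, x2)))
        \<le> dist ((F ^^ n) (y, x1)) (?c n) + dist ((F ^^ n) (y, x2)) (?c n)"
      using dist_triangle2[of "(F ^^ n) (y, x1)" "(F ^^ n) (y, x2)" "?c n"] by simp
  qed
qed

lemma synchronized_borel: "synchronized \<in> sets borel"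
proof -
  have Fn: "continuous_on UNIV (F ^^ n)" for n
  proof (induction n)
    case (Suc n)
    show ?case using continuous_on_compose2[OF F_cont Suc] by (simp add: o_def)
  qed (simp add: continuous_on_id id_def)
  have "continuous_on UNIV (\<lambda>p. dist ((F ^^ n) p) ((F ^^ n) (fst p, to_circle 0)))" for n
    by (intro continuous_on_dist Fn continuous_on_compose2[OF Fn] continuous_on_Pair continuous_on_fst
        continuous_on_const continuous_on_id) auto
  then have [measurable]: "(\<lambda>p. dist ((F ^^ n) p) ((F ^^ n) (fst p, to_circle 0))) \<in> borel_measurable borel" for n
    by (rule borel_measurable_continuous_onI)
  have "Measurable.pred borel (\<lambda>p. (\<lambda>n. dist ((F ^^ n) p) ((F ^^ n) (fst p, to_circle 0))) \<longlonglongrightarrow> 0)"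
    by measurable
  then show ?thesis by (simp add: synchronized_def pred_def)
qed

text \<open>For each fixed \<open>x\<close>, lemma \<open>synchronization_AE\<close> gives membership over almost every \<open>y\<close>; the order of
  the two quantifiers is exchanged before passing to the plane.\<close>

lemma synchronized_full: "- synchronized \<in> null_sets torus_lebesgue"
proof -
  have iff: "to_torus (y, x) \<in> synchronized \<longleftrightarrow> (\<lambda>n. cdist (\<Phi> n y x) (\<Phi> n y 0)) \<longlonglongrightarrow> 0" for y x
  proof -
    have "dist ((F ^^ n) (to_torus (y, x))) ((F ^^ n) (fst (to_torus (y, x)), to_circle 0)) = cdist (\<Phi> n y x) (\<Phi> n y 0)" for n
      using F_iterate[of n y x] F_iterate[of n y 0] by (simp add: dist_prod_def)
    then show ?thesis by (simp add: synchronized_def)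
  qed
  have m: "to_torus -` synchronized \<in> sets borel"
    using measurable_sets[OF borel_measurable_continuous_onI[OF continuous_on_to_torus] synchronized_borel] by simp
  have m2: "{z \<in> space (lborel \<Otimes>\<^sub>M lborel). to_torus z \<in> synchronized} \<in> sets (lborel \<Otimes>\<^sub>M lborel)"
    unfolding lborel_prod using m by (simp add: vimage_def)
  have "AE x in lborel. AE y in lborel. to_torus (y, x) \<in> synchronized"
    unfolding iff using synchronization_AE by simp
  then have "AE y in lborel. AE x in lborel. to_torus (y, x) \<in> synchronized"
    using lborel_pair.AE_commute[of "\<lambda>y x. to_torus (y, x) \<in> synchronized"] m2 by simp
  then have AE: "AE z in lborel. to_torus z \<in> synchronized"
    using lborel_pair.AE_pair_measure[of "\<lambda>z. to_torus z \<in> synchronized"] m2 by (simp only: lborel_prod)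
  define S :: "(real \<times> real) set" where "S = {0..<1} \<times> {0..<1}"
  have S: "S \<in> sets lborel" unfolding S_def by (simp add: borel_Times)
  have null: "to_torus -` (- synchronized) \<in> null_sets lborel"
    using AE m by (subst (asm) AE_iff_null) (auto simp: vimage_def Collect_neg_eq)
  have "- synchronized \<in> null_sets (distr (restrict_space lborel S) borel to_torus)"
  proof (rule null_setsI)
    have "emeasure (distr (restrict_space lborel S) borel to_torus) (- synchronized)
        = emeasure (restrict_space lborel S) (to_torus -` (- synchronized) \<inter> space (restrict_space lborel S))"
      using synchronized_borel measurable_to_torus by (intro emeasure_distr) (auto simp: S_def)
    also have "\<dots> = emeasure lborel (to_torus -` (- synchronized) \<inter> space (restrict_space lborel S))"
      using S by (intro emeasure_restrict_space) (auto simp: space_restrict_space)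
    also have "\<dots> = 0"
      using null S by (intro null_setsD1 null_set_Int2) (auto simp: space_restrict_space)
    finally show "emeasure (distr (restrict_space lborel S) borel to_torus) (- synchronized) = 0" .
    show "- synchronized \<in> sets (distr (restrict_space lborel S) borel to_torus)"
      using synchronized_borel by auto
  qed
  then show ?thesis unfolding torus_lebesgue_def S_def by (rule null_sets_completionI)
qed

end

section \<open>The model as a smooth skew product\<close>

text \<open>Smoothness is shown without computing iterated derivatives, by exhibiting a class of functions that
  is closed under differentiation.\<close>

lemma smooth_if_derivative_closed:
  assumes "A \<in> S"
    and closed: "\<And>f v. f \<in> S \<Longrightarrow> v \<in> Basis \<Longrightarrow>
      \<exists>f'\<in>S. \<exists>D. (\<forall>z. (f has_derivative D z) (at z)) \<and> (\<forall>z. D z v = f' z)"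
  shows "smooth A"
proof -
  have "iter_deriv vs A \<in> S" if "set vs \<subseteq> Basis" for vs
    using that
  proof (induction vs)
    case (Cons v vs)
    then obtain f' D where f': "f' \<in> S" "\<forall>z. (iter_deriv vs A has_derivative D z) (at z)" "\<forall>z. D z v = f' z"
      using closed[of "iter_deriv vs A" v] by auto
    have "iter_deriv (v # vs) A z = f' z" for z
      using frechet_derivative_at[OF f'(2)[rule_format, of z]] f'(3) by (metis iter_deriv.simps(2))
    then have "iter_deriv (v # vs) A = f'" ..
    with f'(1) show ?case by simp
  qed (simp add: assms(1))
  moreover have "f differentiable at z" if "f \<in> S" for f z
    using closed[OF that SOME_Basis] by (meson differentiable_def)
  ultimately show ?thesis unfolding smooth_def by blast
qed

lemma smooth_real_if_derivative_closed:
  fixes A :: "real \<Rightarrow> real"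
  assumes "A \<in> S"
    and closed: "\<And>f. f \<in> S \<Longrightarrow> \<exists>f'\<in>S. \<forall>t. (f has_real_derivative f' t) (at t)"
  shows "smooth A"
proof (rule smooth_if_derivative_closed[OF assms(1)])
  fix f and v :: real assume "f \<in> S" "v \<in> Basis"
  moreover obtain f' where "f' \<in> S" "\<forall>t. (f has_real_derivative f' t) (at t)" using closed[OF \<open>f \<in> S\<close>] by blast
  ultimately show "\<exists>f'\<in>S. \<exists>D. (\<forall>z. (f has_derivative D z) (at z)) \<and> (\<forall>z. D z v = f' z)"
    by (intro bexI[of _ f'] exI[of _ "\<lambda>z h. f' z * h"]) (auto simp: has_field_derivative_def)
qed

definition trig_affine :: "real \<Rightarrow> (real \<Rightarrow> real) set" where
  "trig_affine s = {\<lambda>t. a * t + c + p * sin (2 * pi * (t + s)) + q * cos (2 * pi * (t + s)) | a c p q. True}"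

lemma smooth_trig_affine: assumes "A \<in> trig_affine s" shows "smooth A"
  using assms
proof (rule smooth_real_if_derivative_closed)
  fix f assume "f \<in> trig_affine s"
  then obtain a c p q where f: "f = (\<lambda>t. a * t + c + p * sin (2 * pi * (t + s)) + q * cos (2 * pi * (t + s)))"
    by (auto simp: trig_affine_def)
  let ?f' = "\<lambda>t. 0 * t + a + (- 2 * pi * q) * sin (2 * pi * (t + s)) + (2 * pi * p) * cos (2 * pi * (t + s))"
  have "\<forall>t. (f has_real_derivative ?f' t) (at t)"
    unfolding f by (auto intro!: derivative_eq_intros simp: algebra_simps)
  moreover have "?f' \<in> trig_affine s" unfolding trig_affine_def by blast
  ultimately show "\<exists>f'\<in>trig_affine s. \<forall>t. (f has_real_derivative f' t) (at t)" by (rule bexI)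
qed

definition trig_affine2 :: "(real \<times> real \<Rightarrow> real \<times> real) set" where
  "trig_affine2 = {\<lambda>z. (a * fst z + c, b * fst z + e * snd z + d +
     p * sin (2 * pi * (fst z + snd z)) + q * cos (2 * pi * (fst z + snd z))) | a b c d e p q. True}"

lemma smooth_trig_affine2: assumes "A \<in> trig_affine2" shows "smooth A"
  using assms
proof (rule smooth_if_derivative_closed)
  fix f and v :: "real \<times> real" assume "f \<in> trig_affine2" and v: "v \<in> Basis"
  then obtain a b c d e p q where f: "f = (\<lambda>z. (a * fst z + c, b * fst z + e * snd z + d +
     p * sin (2 * pi * (fst z + snd z)) + q * cos (2 * pi * (fst z + snd z))))"
    by (auto simp: trig_affine2_def)
  let ?arg = "\<lambda>z :: real \<times> real. 2 * pi * (fst z + snd z)"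
  let ?D = "\<lambda>z h. (a * fst h + 0, b * fst h + e * snd h + 0 + p * (?arg h * cos (?arg z)) + q * (?arg h * - sin (?arg z)))"
  have arg: "(?arg has_derivative ?arg) (at z)" for z
    by (intro has_derivative_mult_right has_derivative_add has_derivative_fst has_derivative_snd has_derivative_ident)
  have D: "(f has_derivative ?D z) (at z)" for z
    unfolding f
    by (intro has_derivative_Pair has_derivative_add has_derivative_mult_right has_derivative_const has_derivative_fst
        has_derivative_snd has_derivative_ident DERIV_compose_FDERIV[OF DERIV_sin arg] DERIV_compose_FDERIV[OF DERIV_cos arg])
  let ?w = "2 * pi * (fst v + snd v)"
  let ?f' = "\<lambda>z. (0 * fst z + a * fst v, 0 * fst z + 0 * snd z + (b * fst v + e * snd v) +
     (- q * ?w) * sin (2 * pi * (fst z + snd z)) + (p * ?w) * cos (2 * pi * (fst z + snd z)))"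
  have mem: "?f' \<in> trig_affine2"
    unfolding trig_affine2_def mem_Collect_eq
    by (rule exI[of _ 0], rule exI[of _ 0], rule exI[of _ "a * fst v"], rule exI[of _ "b * fst v + e * snd v"],
        rule exI[of _ 0], rule exI[of _ "- q * ?w"], rule exI[of _ "p * ?w"]) simp
  have ex: "\<exists>D. (\<forall>z. (f has_derivative D z) (at z)) \<and> (\<forall>z. D z v = ?f' z)"
  proof (intro exI[of _ ?D] conjI allI)
    fix z
    show "(f has_derivative ?D z) (at z)" by (rule D)
    show "?D z v = ?f' z" by (simp add: algebra_simps)
  qed
  show "\<exists>f'\<in>trig_affine2. \<exists>D. (\<forall>z. (f has_derivative D z) (at z)) \<and> (\<forall>z. D z v = f' z)"
    by (rule bexI[where x = ?f', OF _ mem]) (rule ex)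
qed

text \<open>Lift of the model fibre map over the base point with representative \<open>s\<close>.\<close>

definition tilt :: "real \<Rightarrow> real \<Rightarrow> real" where "tilt s x = x + wobble (x + s)"

lemma smooth_tilt: "smooth (tilt s)"
proof (rule smooth_trig_affine)
  have "tilt s = (\<lambda>t. 1 * t + 0 + (1 / (4 * pi)) * sin (2 * pi * (t + s)) + 0 * cos (2 * pi * (t + s)))"
    by (auto simp: tilt_def wobble_def fun_eq_iff)
  then show "tilt s \<in> trig_affine s" unfolding trig_affine_def by blast
qed

lemma tilt_deriv: "(tilt s has_real_derivative 1 + cos (2 * pi * (t + s)) / 2) (at t)"
  unfolding tilt_def[abs_def] wobble_def by (auto intro!: derivative_eq_intros simp: field_simps)

lemma tilt_expand: assumes "x \<le> y" shows "(y - x) / 2 \<le> tilt s y - tilt s x"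
proof -
  have "(y - x) * (1/2) \<le> (y - x) * (1 + stretch (x + s) (y - x))"
    using assms stretch_abs_le[of "x + s" "y - x"] by (intro mult_left_mono) (auto simp: abs_le_iff)
  then show ?thesis
    using wobble_diff_stretch[of "x + s" "y - x"] by (simp add: tilt_def algebra_simps)
qed

lemma tilt_int: "tilt s (x + of_int m) = tilt s x + of_int m"
proof -
  have "wobble (t + of_int m) = wobble t" for t
  proof -
    have "sin (pi * of_int m) = 0" unfolding sin_zero_iff_int2 by (rule exI[of _ m]) simp
    then show ?thesis using wobble_diff[of t "of_int m"] by simp
  qed
  from this[of "x + s"] show ?thesis by (simp add: tilt_def add_ac)
qed

definition untilt :: "real \<Rightarrow> real \<Rightarrow> real" where "untilt s y = (SOME x. tilt s x = y)"

lemma tilt_untilt: "tilt s (untilt s y) = y"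
proof -
  define m where "m = 2 * \<bar>y - tilt s 0\<bar>"
  have "tilt s (- m) \<le> y" "y \<le> tilt s m"
    using tilt_expand[of 0 m s] tilt_expand[of "-m" 0 s] by (auto simp: m_def)
  moreover have "continuous_on {- m..m} (tilt s)" by (rule smooth_continuous[OF smooth_tilt])
  ultimately have "\<exists>x. - m \<le> x \<and> x \<le> m \<and> tilt s x = y"
    by (intro IVT') (auto simp: m_def)
  then have "\<exists>x. tilt s x = y" by blast
  then show ?thesis unfolding untilt_def by (rule someI_ex)
qed

lemma tilt_inj: "tilt s x = tilt s y \<longleftrightarrow> x = y"
  using tilt_expand[of x y s] tilt_expand[of y x s] by (cases x y rule: linorder_cases) auto

lemma untilt_deriv: "(untilt s has_real_derivative inverse (1 + cos (2 * pi * (untilt s y + s)) / 2)) (at y)"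
proof (rule DERIV_inverse_function)
  show "(tilt s has_real_derivative 1 + cos (2 * pi * (untilt s y + s)) / 2) (at (untilt s y))" by (rule tilt_deriv)
  have "-1 \<le> cos (2 * pi * (untilt s y + s))" by simp
  then show "1 + cos (2 * pi * (untilt s y + s)) / 2 \<noteq> 0" by linarith
  show "y - 1 < y" "y < y + 1" by simp_all
  show "tilt s (untilt s t) = t" for t by (rule tilt_untilt)
  have "2-lipschitz_on UNIV (untilt s)"
  proof (rule lipschitz_onI)
    fix t u
    show "dist (untilt s t) (untilt s u) \<le> 2 * dist t u"
      using tilt_expand[of "untilt s t" "untilt s u" s] tilt_expand[of "untilt s u" "untilt s t" s]
      by (cases "untilt s t \<le> untilt s u") (auto simp: tilt_untilt dist_real_def abs_if)
  qed simp
  then show "isCont (untilt s) y"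
    using lipschitz_on_continuous_on continuous_on_eq_continuous_at open_UNIV by blast
qed

text \<open>The derivative of the inverse fibre map is a function of that inverse again. The functions below are
  closed under differentiation, since \<open>sin\<close>, \<open>cos\<close> and the reciprocal all differentiate into products
  of each other.\<close>

inductive_set untilt_algebra :: "real \<Rightarrow> (real \<Rightarrow> real) set" for s where
  const: "(\<lambda>_. c) \<in> untilt_algebra s"
| sin: "(\<lambda>y. sin (2 * pi * (untilt s y + s))) \<in> untilt_algebra s"
| cos: "(\<lambda>y. cos (2 * pi * (untilt s y + s))) \<in> untilt_algebra s"
| inv: "(\<lambda>y. inverse (1 + cos (2 * pi * (untilt s y + s)) / 2)) \<in> untilt_algebra s"
| add: "f \<in> untilt_algebra s \<Longrightarrow> g \<in> untilt_algebra s \<Longrightarrow> (\<lambda>y. f y + g y) \<in> untilt_algebra s"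
| mult: "f \<in> untilt_algebra s \<Longrightarrow> g \<in> untilt_algebra s \<Longrightarrow> (\<lambda>y. f y * g y) \<in> untilt_algebra s"

lemma untilt_algebra_deriv:
  assumes "f \<in> untilt_algebra s"
  shows "\<exists>f'\<in>untilt_algebra s. \<forall>t. (f has_real_derivative f' t) (at t)"
  using assms
proof induction
  let ?S = "\<lambda>y. sin (2 * pi * (untilt s y + s))" and ?C = "\<lambda>y. cos (2 * pi * (untilt s y + s))"
    and ?I = "\<lambda>y. inverse (1 + cos (2 * pi * (untilt s y + s)) / 2)"
  note intros = untilt_algebra.intros
  {
    case (const c)
    show ?case by (rule bexI[where x = "\<lambda>_. 0"]) (simp, rule intros)
  next
    case sin
    have "\<forall>t. (?S has_real_derivative 2 * pi * (?C t * ?I t)) (at t)"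
      by (auto intro!: derivative_eq_intros untilt_deriv)
    moreover have "(\<lambda>t. 2 * pi * (?C t * ?I t)) \<in> untilt_algebra s" by (intro intros)
    ultimately show ?case by (rule bexI)
  next
    case cos
    have "\<forall>t. (?C has_real_derivative (- 2 * pi) * (?S t * ?I t)) (at t)"
      by (auto intro!: derivative_eq_intros untilt_deriv)
    moreover have "(\<lambda>t. (- 2 * pi) * (?S t * ?I t)) \<in> untilt_algebra s" by (intro intros)
    ultimately show ?case by (rule bexI)
  next
    case inv
    have "-1 \<le> ?C t" for t by simp
    then have nz: "1 + ?C t / 2 \<noteq> 0" for t by (smt (verit) field_sum_of_halves)
    have "\<forall>t. (?I has_real_derivative pi * (?S t * (?I t * (?I t * ?I t)))) (at t)"
      using nz by (auto intro!: derivative_eq_intros untilt_deriv simp: power2_eq_square field_simps)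
    moreover have "(\<lambda>t. pi * (?S t * (?I t * (?I t * ?I t)))) \<in> untilt_algebra s" by (intro intros)
    ultimately show ?case by (rule bexI)
  next
    case (add f g)
    then obtain f' g' where "f' \<in> untilt_algebra s" "g' \<in> untilt_algebra s"
      "\<forall>t. (f has_real_derivative f' t) (at t)" "\<forall>t. (g has_real_derivative g' t) (at t)" by blast
    then show ?case by (intro bexI[of _ "\<lambda>t. f' t + g' t"] allI DERIV_add intros) auto
  next
    case (mult f g)
    then obtain f' g' where d: "f' \<in> untilt_algebra s" "g' \<in> untilt_algebra s"
      "\<forall>t. (f has_real_derivative f' t) (at t)" "\<forall>t. (g has_real_derivative g' t) (at t)" by blast
    have "\<forall>t. ((\<lambda>t. f t * g t) has_real_derivative f' t * g t + g' t * f t) (at t)"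
      using d by (intro allI DERIV_mult) auto
    moreover have "(\<lambda>t. f' t * g t + g' t * f t) \<in> untilt_algebra s" using d mult by (intro intros)
    ultimately show ?case by (rule bexI)
  }
qed

lemma smooth_untilt: "smooth (untilt s)"
proof (rule smooth_real_if_derivative_closed[where S = "insert (untilt s) (untilt_algebra s)"])
  fix f assume "f \<in> insert (untilt s) (untilt_algebra s)"
  then have "\<exists>f'\<in>untilt_algebra s. \<forall>t. (f has_real_derivative f' t) (at t)"
  proof (elim insertE)
    assume "f = untilt s"
    then show ?thesis
      by (intro bexI[where x = "\<lambda>t. inverse (1 + cos (2 * pi * (untilt s t + s)) / 2)"])
        (simp_all add: untilt_deriv untilt_algebra.inv)
  qed (rule untilt_algebra_deriv)
  then show "\<exists>f'\<in>insert (untilt s) (untilt_algebra s). \<forall>t. (f has_real_derivative f' t) (at t)"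
    by blast
qed simp

definition model_base :: "circle \<Rightarrow> circle"
  where "model_base t = to_circle (1000000 * rep_circle t)"

definition model_fiber :: "circle \<Rightarrow> circle \<Rightarrow> circle"
  where "model_fiber t u = to_circle (tilt (rep_circle t) (rep_circle u))"

lemma rep_to_circle: "\<exists>m. rep_circle (to_circle x) = x + of_int m"
proof -
  have "to_circle (rep_circle (to_circle x)) = to_circle x" by (metis Quotient_circle Quotient_abs_rep)
  then have "rep_circle (to_circle x) - x \<in> \<int>" by (simp add: to_circle_eq_iff)
  then obtain m where "rep_circle (to_circle x) - x = of_int m" by (auto elim: Ints_cases)
  then show ?thesis by (intro exI[of _ m]) simp
qed

lemma model_base_lift: "model_base (to_circle y) = to_circle (1000000 * y)"
proof -
  obtain m where "rep_circle (to_circle y) = y + of_int m" using rep_to_circle by blast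
  then have "1000000 * rep_circle (to_circle y) = 1000000 * y + of_int (1000000 * m)" by simp
  then show ?thesis unfolding model_base_def by (simp only: to_circle_add_int)
qed

lemma model_fiber_lift_base: "model_fiber t (to_circle x) = to_circle (tilt (rep_circle t) x)"
proof -
  obtain m where "rep_circle (to_circle x) = x + of_int m" using rep_to_circle by blast
  then show ?thesis unfolding model_fiber_def by (simp only: tilt_int to_circle_add_int)
qed

lemma model_fiber_lift: "model_fiber (to_circle y) (to_circle x) = to_circle (x + wobble (y + x))"
proof -
  obtain m where "rep_circle (to_circle y) = y + of_int m" using rep_to_circle by blast
  then have "tilt (rep_circle (to_circle y)) x = tilt y (x + of_int m) - of_int m" by (simp add: tilt_def add_ac)
  also have "\<dots> = x + wobble (y + x)" unfolding tilt_int by (simp add: tilt_def add.commute)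
  finally show ?thesis unfolding model_fiber_lift_base by simp
qed

lemma model_fiber_diffeo: "circle_diffeo (model_fiber t)"
proof -
  let ?s = "rep_circle t"
  have inj: "inj (model_fiber t)"
  proof (rule injI)
    fix u v assume eq: "model_fiber t u = model_fiber t v"
    obtain x y where xy: "to_circle x = u" "to_circle y = v" using to_circle_surj by metis
    have "tilt ?s x - tilt ?s y \<in> \<int>"
      using eq unfolding xy[symmetric] model_fiber_lift_base to_circle_eq_iff .
    then obtain m where "tilt ?s x - tilt ?s y = of_int m" by (auto elim: Ints_cases)
    then have "tilt ?s x = tilt ?s (y + of_int m)" by (simp add: tilt_int)
    then show "u = v" unfolding tilt_inj xy[symmetric] by simp
  qed
  have right_inv: "model_fiber t (to_circle (untilt ?s y)) = to_circle y" for y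
    by (simp add: model_fiber_lift_base tilt_untilt)
  have "surj (model_fiber t)" using right_inv to_circle_surj unfolding surj_def by metis
  moreover have "circle_lift (tilt ?s) (model_fiber t)"
    by (simp add: circle_lift_def smooth_tilt model_fiber_lift_base)
  moreover have "circle_lift (untilt ?s) (inv (model_fiber t))"
    using inj right_inv by (simp add: circle_lift_def smooth_untilt) (metis inv_f_f)
  ultimately show ?thesis using inj unfolding circle_diffeo_def smooth_circle_map_def bij_def by blast
qed

lemma model_torus_lift: "torus_lift model_lift (skew_product model_base model_fiber)"
proof -
  have "model_lift = (\<lambda>z. (1000000 * fst z + 0, 0 * fst z + 1 * snd z + 0 +
      (1 / (4 * pi)) * sin (2 * pi * (fst z + snd z)) + 0 * cos (2 * pi * (fst z + snd z))))"
    by (auto simp: model_lift_def wobble_def fun_eq_iff)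
  then have "model_lift \<in> trig_affine2" unfolding trig_affine2_def by blast
  then have "smooth model_lift" by (rule smooth_trig_affine2)
  moreover have "to_torus (model_lift z) = skew_product model_base model_fiber (to_torus z)" for z
    by (cases z) (simp add: model_lift_def skew_product_def model_base_lift model_fiber_lift)
  ultimately show ?thesis unfolding torus_lift_def by blast
qed

lemma model_in_smooth_skew_products: "skew_product model_base model_fiber \<in> smooth_skew_products"
proof -
  have "(\<lambda>t. 1000000 * t) = (\<lambda>t. 1000000 * t + 0 + 0 * sin (2 * pi * (t + 0)) + 0 * cos (2 * pi * (t + 0)))"
    by simp
  then have "(\<lambda>t. 1000000 * t) \<in> trig_affine 0" unfolding trig_affine_def by blast
  then have "circle_lift (\<lambda>t. 1000000 * t) model_base"
    by (simp add: circle_lift_def smooth_trig_affine model_base_lift)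
  then show ?thesis
    using model_torus_lift model_fiber_diffeo
    unfolding smooth_skew_products_def smooth_circle_map_def smooth_torus_map_def by blast
qed

section \<open>The open set of mixing and synchronizing maps\<close>

theorem theorem1p1:
  fixes k :: nat
  assumes "k \<ge> 2"
  shows "\<exists>\<U>. openin (skew_product_topology k) \<U> \<and> \<U> \<noteq> {} \<and>
    (\<forall>F\<in>\<U>.
      (\<exists>g f. F = skew_product g f \<and> expanding g \<and> (\<forall>y. circle_diffeo (f y))) \<and>
      topologically_mixing F \<and>
      (\<exists>\<Lambda> :: torus set. - \<Lambda> \<in> null_sets torus_lebesgue \<and>
        (\<forall>y x\<^sub>1 x\<^sub>2. (y, x\<^sub>1) \<in> \<Lambda> \<and> (y, x\<^sub>2) \<in> \<Lambda> \<longrightarrow>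
          (\<lambda>n. dist ((F ^^ n) (y, x\<^sub>1)) ((F ^^ n) (y, x\<^sub>2))) \<longlonglongrightarrow> 0)))"
proof (intro exI[of _ "near_model \<inter> smooth_skew_products"] conjI ballI)
  show "openin (skew_product_topology k) (near_model \<inter> smooth_skew_products)"
    unfolding skew_product_topology_def openin_subtopology using openin_near_model[of k] assms by auto
  have "skew_product model_base model_fiber \<in> near_model"
    unfolding near_model_def using model_torus_lift by (auto intro!: exI[of _ model_lift] exI[of _ 0])
  then show "near_model \<inter> smooth_skew_products \<noteq> {}" using model_in_smooth_skew_products by blast
next
  fix F assume F: "F \<in> near_model \<inter> smooth_skew_products"
  then obtain g f where gf: "F = skew_product g f" "smooth_circle_map g" "\<forall>y. circle_diffeo (f y)"
    by (auto simp: smooth_skew_products_def)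
  have near: "F \<in> near_model" using F by simp
  show "\<exists>g f. F = skew_product g f \<and> expanding g \<and> (\<forall>y. circle_diffeo (f y))"
    using near_model_expanding[OF gf(1) near gf(2)] gf by blast
  obtain b b' B where lift: "forced_lift b b' B 1000000 (1/1000000)"
    "\<And>y x. F (to_torus (y, x)) = to_torus (b y, B y x)"
    using near_model_lift[OF gf(1) near] by blast
  have "continuous_on UNIV F" using near torus_lift_continuous by (auto simp: near_model_def)
  then interpret forced_torus_map b b' B 1000000 "1/1000000" F
    using lift by (auto simp: forced_torus_map_def forced_torus_map_axioms_def simp del: to_torus_simp)
  show "topologically_mixing F" by (rule torus_mixing)
  show "\<exists>\<Lambda> :: torus set. - \<Lambda> \<in> null_sets torus_lebesgue \<and>
        (\<forall>y x\<^sub>1 x\<^sub>2. (y, x\<^sub>1) \<in> \<Lambda> \<and> (y, x\<^sub>2) \<in> \<Lambda> \<longrightarrow>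
          (\<lambda>n. dist ((F ^^ n) (y, x\<^sub>1)) ((F ^^ n) (y, x\<^sub>2))) \<longlonglongrightarrow> 0)"
    using synchronized_full synchronized_pair by blast
qed

end
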